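(* Let $\nu>0$, let $\chi_\omega\in L^\infty(\mathbb{T}^3)$ be nonnegative, let $t\mapsto K(\rho(t))$ be a bounded measurable nonnegative function on $[0,\infty)$, and let $\varphi_1,\dots,\varphi_N\in V$ be orthonormal in $H$. Let $S_{ij}:=\nu\langle\nabla\varphi_i,\nabla\varphi_j\rangle_{L^2}$ and $(M_\omega)_{ij}:=\langle\chi_\omega\varphi_i,\varphi_j\rangle_{L^2}$. Assume that $K(\rho(t))\ge K_{\min}>0$ for (almost every) $t\ge 0$, and set $\alpha_{\omega,N}:=\lambda_{\min}(S+K_{\min}M_\omega)$. Then any solution $z:[0,\infty)\to\mathbb{R}^N$ of the reduced-order system $$\dot z(t)=-\big(S+K(\rho(t))M_\omega\big)z(t)+\mathcal{N}_N(z(t))$$ satisfies $$\|z(t)\|\le e^{-\alpha_{\omega,N}t}\|z(0)\|,\qquad\forall t\ge 0.$$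
   Context: $\mathbb{T}^3=(\mathbb{R}/\mathbb{Z})^3$. $H:=\{v\in L^2(\mathbb{T}^3;\mathbb{R}^3): \nabla\cdot v=0,\ \int_{\mathbb{T}^3}v\,dx=0\}$ with the $L^2$ inner product, and $V:=H^1(\mathbb{T}^3;\mathbb{R}^3)\cap H$. $\lambda_{\min}$ denotes the smallest eigenvalue of a real symmetric matrix and $\|\cdot\|$ the Euclidean norm on $\mathbb{R}^N$. The system is the Galerkin projection onto $H_N=\mathrm{span}\{\varphi_1,\dots,\varphi_N\}$ of the damped Navier--Stokes equations $\partial_tu+(u\cdot\nabla)u-\nu\Delta u+\nabla p=-\chi_\omega K(\rho(t))u$, $\nabla\cdot u=0$. The reduced convection operator $\mathcal{N}_N:\mathbb{R}^N\to\mathbb{R}^N$ is $$(\mathcal{N}_N(z))_i:=-\int_{\mathbb{T}^3}(v_N\cdot\nabla)v_N\cdot\varphi_i\,dx,\qquad v_N=\sum_{j=1}^Nz_j\varphi_j.$$ A solution is a locally absolutely continuous function satisfying the system for almost every $t\ge 0$. *)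

theory Defs
  imports "HOL-Analysis.Analysis"
begin

text \<open>A function on the torus \<open>(\<real>/\<int>)\<^sup>3\<close> is a function on \<open>\<real>\<^sup>3\<close> that is 1-periodic in every
  coordinate, and integration over the torus is integration over one period cell. Elements of
  \<open>L\<^sup>2\<close> and \<open>L\<^sup>\<infinity>\<close> are represented by functions, not by classes modulo null sets.\<close>

definition periodic :: "(real^3 \<Rightarrow> 'a) \<Rightarrow> bool" where
  "periodic f \<longleftrightarrow> (\<forall>x k. f (x + axis k 1) = f x)"

definition torus :: "(real^3) measure" where
  "torus = lebesgue_on (cbox 0 1)"

definition torus_L2 :: "(real^3 \<Rightarrow> 'a::euclidean_space) set" where
  "torus_L2 = {f. periodic f \<and> f \<in> borel_measurable torus \<and>
                  integrable torus (\<lambda>x. (norm (f x))\<^sup>2)}"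

definition torus_Linf :: "(real^3 \<Rightarrow> real) set" where
  "torus_Linf = {f. periodic f \<and> f \<in> borel_measurable torus \<and>
                    (\<exists>C. AE x in torus. \<bar>f x\<bar> \<le> C)}"

text \<open>For matrix-valued functions the pointwise inner product below is the Frobenius one.\<close>

definition L2_inner :: "(real^3 \<Rightarrow> 'a::euclidean_space) \<Rightarrow> (real^3 \<Rightarrow> 'a) \<Rightarrow> real" where
  "L2_inner f g = (LINT x|torus. f x \<bullet> g x)"

definition partial_deriv :: "3 \<Rightarrow> (real^3 \<Rightarrow> real) \<Rightarrow> real^3 \<Rightarrow> real" where
  "partial_deriv k f x = frechet_derivative f (at x) (axis k 1)"

primrec C_k :: "nat \<Rightarrow> (real^3 \<Rightarrow> real) \<Rightarrow> bool" where
  "C_k 0 f \<longleftrightarrow> continuous_on UNIV f"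
| "C_k (Suc n) f \<longleftrightarrow> (\<forall>x. f differentiable (at x)) \<and> (\<forall>k. C_k n (partial_deriv k f))"

definition test_functions :: "(real^3 \<Rightarrow> real) set" where
  "test_functions = {\<psi>. periodic \<psi> \<and> (\<forall>n. C_k n \<psi>)}"

text \<open>\<open>G x $ i $ k\<close> is the weak derivative of the \<open>i\<close>-th component in direction \<open>k\<close>.\<close>

definition is_weak_grad :: "(real^3 \<Rightarrow> real^3) \<Rightarrow> (real^3 \<Rightarrow> real^3^3) \<Rightarrow> bool" where
  "is_weak_grad v G \<longleftrightarrow>
     (\<forall>\<psi>\<in>test_functions. \<forall>i k.
        (LINT x|torus. v x $ i * partial_deriv k \<psi> x) = - (LINT x|torus. G x $ i $ k * \<psi> x))"

definition weakly_div_free :: "(real^3 \<Rightarrow> real^3) \<Rightarrow> bool" where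
  "weakly_div_free v \<longleftrightarrow>
     (\<forall>\<psi>\<in>test_functions. (LINT x|torus. (\<Sum>k\<in>UNIV. v x $ k * partial_deriv k \<psi> x)) = 0)"

definition H1 :: "(real^3 \<Rightarrow> real^3) set" where
  "H1 = {v \<in> torus_L2. \<exists>G\<in>torus_L2. is_weak_grad v G}"

text \<open>A square-integrable weak gradient is unique up to null sets; for \<open>v \<in> H1\<close> the choice of
  representative does not affect any of the integrals below.\<close>

definition weak_grad :: "(real^3 \<Rightarrow> real^3) \<Rightarrow> real^3 \<Rightarrow> real^3^3" where
  "weak_grad v = (SOME G. G \<in> torus_L2 \<and> is_weak_grad v G)"

definition H :: "(real^3 \<Rightarrow> real^3) set" where
  "H = {v \<in> torus_L2. weakly_div_free v \<and> (LINT x|torus. v x) = 0}"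

definition V :: "(real^3 \<Rightarrow> real^3) set" where
  "V = H1 \<inter> H"

definition stiffness :: "real \<Rightarrow> ('n::finite \<Rightarrow> real^3 \<Rightarrow> real^3) \<Rightarrow> real^'n^'n" where
  "stiffness \<nu> \<phi> = (\<chi> i j. \<nu> * L2_inner (weak_grad (\<phi> i)) (weak_grad (\<phi> j)))"

definition damping :: "(real^3 \<Rightarrow> real) \<Rightarrow> ('n::finite \<Rightarrow> real^3 \<Rightarrow> real^3) \<Rightarrow> real^'n^'n" where
  "damping c \<phi> = (\<chi> i j. L2_inner (\<lambda>x. c x *\<^sub>R \<phi> i x) (\<phi> j))"

definition galerkin_field ::
    "('n::finite \<Rightarrow> real^3 \<Rightarrow> real^3) \<Rightarrow> real^'n \<Rightarrow> real^3 \<Rightarrow> real^3" where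
  "galerkin_field \<phi> z x = (\<Sum>j\<in>UNIV. z $ j *\<^sub>R \<phi> j x)"

text \<open>With the index convention of \<open>is_weak_grad\<close>, \<open>(v \<cdot> \<nabla>) w\<close> is the matrix-vector product
  \<open>(\<nabla>w) v\<close>.\<close>

definition convection :: "('n::finite \<Rightarrow> real^3 \<Rightarrow> real^3) \<Rightarrow> real^'n \<Rightarrow> real^'n" where
  "convection \<phi> z =
     (let v = galerkin_field \<phi> z
      in (\<chi> i. - L2_inner (\<lambda>x. weak_grad v x *v v x) (\<phi> i)))"

definition eigenvalues :: "real^'n^'n \<Rightarrow> real set" where
  "eigenvalues A = {l. \<exists>x. x \<noteq> 0 \<and> A *v x = l *\<^sub>R x}"

definition lambda_min :: "real^'n^'n \<Rightarrow> real" where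
  "lambda_min A = Min (eigenvalues A)"

definition abs_continuous_on :: "real \<Rightarrow> real \<Rightarrow> (real \<Rightarrow> 'a::metric_space) \<Rightarrow> bool" where
  "abs_continuous_on s t f \<longleftrightarrow>
     (\<forall>e>0. \<exists>d>0. \<forall>(n::nat) a b.
        (\<forall>i<n. s \<le> a i \<and> a i \<le> b i \<and> b i \<le> t) \<and>
        disjoint_family_on (\<lambda>i. {a i<..<b i}) {..<n} \<and> (\<Sum>i<n. b i - a i) < d
        \<longrightarrow> (\<Sum>i<n. dist (f (a i)) (f (b i))) < e)"

end

theory Submission
  imports Defs
begin

text \<open>Since \<open>z \<bullet> convection \<phi> z = 0\<close>, the energy \<open>(norm z)\<^sup>2\<close> satisfies a differential inequality
  governed by the smallest eigenvalue, and Gronwall's inequality holds for absolutely continuous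
  functions. The cancellation is \<open>\<integral> v \<bullet> \<nabla>((norm v)\<^sup>2 / 2) = 0\<close> for weakly divergence-free \<open>v\<close>. It is
  exact when the two convected copies of \<open>v\<close> are replaced by Fourier partial sums, whose squares are
  admissible test functions. Passing to the limit, and even the integrability of the convection
  terms, needs the embedding \<open>H\<^sup>1 \<subseteq> L\<^sup>4\<close> in dimension three; for trigonometric polynomials
  it is an elementary inequality between coefficients, because the Fourier coefficients of the
  square are the convolution of the coefficients.\<close>

subsection \<open>Decay of absolutely continuous energies\<close>

text \<open>The square of \<open>v\<close> is not smooth enough to test weak divergence-freeness
  with, while that condition is linear in the convecting copy of \<open>v\<close>, so this copy can
  stay exact. Truncating a Fourier series commutes with weak differentiation: the gradients of the
  partial sums converge in mean square because they are partial sums of the weak gradient, and only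
  products of components of \<open>v\<close> need more than square-integrability. Completeness of
  the modes comes from Stone--Weierstrass on the image of the unit cube in six-dimensional space;
  functions on the cube need not match on opposite faces, so they are first cut off at the boundary.
  On the side of the differential equation, the derivative exists only almost everywhere, so decay
  of the weighted energy is obtained from a gauge argument. The rate is taken at the constant
  \<open>Kmin\<close> because the form of \<open>S + k M\<close> is nondecreasing in
  \<open>k\<close>, as \<open>M\<close> is positive semidefinite.\<close>

lemma abs_continuous_onE:
  assumes "abs_continuous_on a b f" "e > 0"
  obtains d where "d > 0"
    "\<forall>(n::nat) u v. (\<forall>i<n. a \<le> u i \<and> u i \<le> v i \<and> v i \<le> b) \<and>
        disjoint_family_on (\<lambda>i. {u i<..<v i}) {..<n} \<and> (\<Sum>i<n. v i - u i) < d
        \<longrightarrow> (\<Sum>i<n. dist (f (u i)) (f (v i))) < e"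
  using spec[OF assms(1)[unfolded abs_continuous_on_def], of e] assms(2) by blast

text \<open>Nothing is known about the derivative on \<open>N\<close>, so \<open>N\<close> is
  enclosed in an open set \<open>U\<close> so small that absolute continuity bounds the variation of
  \<open>g\<close> over disjoint intervals inside \<open>U\<close> by \<epsilon>. In a division fine
  for a suitable gauge, intervals tagged outside \<open>N\<close> contribute at most \<epsilon>
  times their length, and those tagged in \<open>N\<close> lie in \<open>U\<close>.\<close>

lemma abs_continuous_on_deriv_nonpos:
  fixes g :: "real \<Rightarrow> real"
  assumes "a \<le> b" and ac: "abs_continuous_on a b g" and N: "negligible N"
    and deriv: "\<And>t. t \<in> {a..b} \<Longrightarrow> t \<notin> N \<Longrightarrow> \<exists>d\<le>0. (g has_real_derivative d) (at t)"
  shows "g b \<le> g a"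
proof -
  have est: "g b - g a \<le> \<epsilon> * (b - a) + \<epsilon>" if "\<epsilon> > 0" for \<epsilon>
  proof -
    obtain \<delta> where \<delta>: "\<delta> > 0"
      and AC: "\<forall>(n::nat) u v. (\<forall>i<n. a \<le> u i \<and> u i \<le> v i \<and> v i \<le> b) \<and>
        disjoint_family_on (\<lambda>i. {u i<..<v i}) {..<n} \<and> (\<Sum>i<n. v i - u i) < \<delta>
        \<longrightarrow> (\<Sum>i<n. dist (g (u i)) (g (v i))) < \<epsilon>"
    by (rule abs_continuous_onE[OF ac \<open>\<epsilon> > 0\<close>])
    obtain U where U: "open U" "N \<subseteq> U" "U \<in> lmeasurable" "measure lebesgue U < \<delta>"
    proof -
      have N0: "N \<in> null_sets lebesgue" using N by (simp add: negligible_iff_null_sets)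
      obtain T where T: "open T" "N \<subseteq> T" "T - N \<in> lmeasurable" "emeasure lebesgue (T - N) < ennreal \<delta>"
        using sets_lebesgue_outer_open[OF null_setsD2[OF N0] \<delta>] .
      have "T = (T - N) \<union> N" using T(2) by blast
      then have *: "emeasure lebesgue T = emeasure lebesgue (T - N)"
        using emeasure_Un_null_set[OF fmeasurableD[OF T(3)] N0] by simp
      have "T \<in> sets lebesgue" using T(1) by simp
      then have TM: "T \<in> lmeasurable" using T(3) * by (auto simp: fmeasurable_def)
      then have "ennreal (measure lebesgue T) < ennreal \<delta>"
        using T(4) * by (simp add: emeasure_eq_measure2)
      then show ?thesis using that[of T] T TM by (simp add: ennreal_less_iff)
    qed
    \<comment> \<open>The growth is estimated on each side of \<open>t\<close> separately: an
      interval of the division contains its tag, and the two estimates add up across the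
      tag.\<close>
    have "\<exists>r>0. \<forall>y. \<bar>y - t\<bar> < r \<longrightarrow>
             (y \<ge> t \<longrightarrow> g y - g t \<le> \<epsilon> * (y - t)) \<and> (y \<le> t \<longrightarrow> g t - g y \<le> \<epsilon> * (t - y))"
      if t: "t \<in> {a..b}" "t \<notin> N" for t
    proof -
      obtain d where d: "d \<le> 0" "(g has_real_derivative d) (at t)" using deriv[OF t] by auto
      from d(2) have "(g has_derivative (\<lambda>h. h * d)) (at t)"
        by (simp add: has_field_derivative_def mult_commute_abs)
      then obtain r where r: "r > 0"
        "\<And>y. norm (y - t) < r \<Longrightarrow> norm (g y - g t - (y - t) * d) \<le> \<epsilon> * norm (y - t)"
        using \<open>\<epsilon> > 0\<close> unfolding has_derivative_at_alt by metis
      have 1: "g y - g t \<le> \<epsilon> * (y - t)" if "\<bar>y - t\<bar> < r" "y \<ge> t" for y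
      proof -
        have "(y - t) * d \<le> 0" using d(1) that by (simp add: mult_nonneg_nonpos)
        then show ?thesis using r(2)[of y] that by auto
      qed
      have 2: "g t - g y \<le> \<epsilon> * (t - y)" if "\<bar>y - t\<bar> < r" "y \<le> t" for y
      proof -
        have "(y - t) * d \<ge> 0" using d(1) that by (simp add: mult_nonpos_nonpos)
        then show ?thesis using r(2)[of y] that by auto
      qed
      show ?thesis using r(1) 1 2 by blast
    qed
    then have "\<forall>t\<in>{a..b} - N. \<exists>r>0. \<forall>y. \<bar>y - t\<bar> < r \<longrightarrow>
             (y \<ge> t \<longrightarrow> g y - g t \<le> \<epsilon> * (y - t)) \<and> (y \<le> t \<longrightarrow> g t - g y \<le> \<epsilon> * (t - y))"
      by blast
    from bchoice[OF this] obtain r where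
      "\<forall>t\<in>{a..b} - N. r t > 0 \<and> (\<forall>y. \<bar>y - t\<bar> < r t \<longrightarrow>
         (y \<ge> t \<longrightarrow> g y - g t \<le> \<epsilon> * (y - t)) \<and> (y \<le> t \<longrightarrow> g t - g y \<le> \<epsilon> * (t - y)))" ..
    then have r: "\<And>t. t \<in> {a..b} \<Longrightarrow> t \<notin> N \<Longrightarrow> r t > 0"
      "\<And>t y. t \<in> {a..b} \<Longrightarrow> t \<notin> N \<Longrightarrow> \<bar>y - t\<bar> < r t \<Longrightarrow> y \<ge> t \<Longrightarrow> g y - g t \<le> \<epsilon> * (y - t)"
      "\<And>t y. t \<in> {a..b} \<Longrightarrow> t \<notin> N \<Longrightarrow> \<bar>y - t\<bar> < r t \<Longrightarrow> y \<le> t \<Longrightarrow> g t - g y \<le> \<epsilon> * (t - y)"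
      by auto
    \<comment> \<open>A gauge assigns an open neighbourhood to every real number, so points outside
      both \<open>N\<close> and \<open>{a..b}\<close>, which never occur as tags, receive
      \<open>UNIV\<close>.\<close>
    define \<gamma> where "\<gamma> t = (if t \<in> N then U else if t \<in> {a..b} then ball t (r t) else UNIV)" for t
    have "gauge \<gamma>"
      unfolding gauge_def \<gamma>_def using U r(1) by auto
    then obtain p where p: "p tagged_division_of {a..b}" "\<gamma> fine p"
      by (rule fine_division_exists_real)
    have fin: "finite p" using p(1) by blast
    have pk: "\<exists>u v. k = {u..v} \<and> u \<le> v \<and> x \<in> {u..v} \<and> a \<le> u \<and> v \<le> b \<and> k \<subseteq> \<gamma> x"
      if "(x, k) \<in> p" for x k
    proof -
      have "\<exists>u v. k = cbox u v" using tagged_division_ofD(4)[OF p(1)] that .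
      then obtain u v where k: "k = cbox u v" by blast
      have x: "x \<in> k" "k \<subseteq> {a..b}"
        using tagged_division_ofD(2,3)[OF p(1)] that by blast+
      have "k \<subseteq> \<gamma> x" using p(2) that by (auto simp: fine_def)
      with k x show ?thesis by (intro exI[of _ u] exI[of _ v]) auto
    qed
    define L where "L k = Inf k" for k :: "real set"
    define R where "R k = Sup k" for k :: "real set"
    have LR: "k = {L k..R k}" "L k \<le> R k" "x \<in> {L k..R k}" "a \<le> L k" "R k \<le> b" "k \<subseteq> \<gamma> x"
      if "(x, k) \<in> p" for x k
      using pk[OF that] by (auto simp: L_def R_def)
    have tele: "(\<Sum>(x,k)\<in>p. h (R k) - h (L k)) = h b - h a" for h :: "real \<Rightarrow> real"
      using additive_tagged_division_1[OF \<open>a \<le> b\<close> p(1), of h] by (simp add: L_def R_def)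
    define q where "q = {(x,k) \<in> p. x \<in> N}"
    have q: "q \<subseteq> p" "finite q" using fin by (auto simp: q_def intro: finite_subset)
    have good: "(\<Sum>(x,k)\<in>p - q. g (R k) - g (L k)) \<le> (\<Sum>(x,k)\<in>p - q. \<epsilon> * (R k - L k))"
    proof (rule sum_mono, clarify)
      fix x k assume xk: "(x, k) \<in> p" "(x, k) \<notin> q"
      have xN: "x \<notin> N" using xk by (auto simp: q_def)
      have x: "x \<in> {a..b}" using LR(3,4,5)[OF xk(1)] by auto
      have sub: "{L k..R k} \<subseteq> ball x (r x)"
        using LR(1,6)[OF xk(1)] x xN by (simp add: \<gamma>_def)
      have "L k \<in> ball x (r x)" "R k \<in> ball x (r x)"
        using sub LR(2)[OF xk(1)] by auto
      then have "\<bar>L k - x\<bar> < r x" "\<bar>R k - x\<bar> < r x"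
        by (auto simp: dist_real_def)
      then have "g (R k) - g x \<le> \<epsilon> * (R k - x)" "g x - g (L k) \<le> \<epsilon> * (x - L k)"
        using r(2)[OF x xN, of "R k"] r(3)[OF x xN, of "L k"] LR(3)[OF xk(1)] by auto
      then show "g (R k) - g (L k) \<le> \<epsilon> * (R k - L k)" by (simp add: algebra_simps)
    qed
    also have "\<dots> \<le> (\<Sum>(x,k)\<in>p. \<epsilon> * (R k - L k))"
      using fin LR(2) \<open>\<epsilon> > 0\<close> by (intro sum_mono2) auto
    also have "\<dots> = \<epsilon> * (b - a)"
      using tele[of "\<lambda>x. \<epsilon> * x"] by (simp add: algebra_simps)
    finally have good: "(\<Sum>(x,k)\<in>p - q. g (R k) - g (L k)) \<le> \<epsilon> * (b - a)" .
    \<comment> \<open>Absolute continuity is defined through finite sequences of intervals, so the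
      intervals tagged in \<open>N\<close> are enumerated.\<close>
    obtain f where f: "bij_betw f {..<card q} q"
      using ex_bij_betw_nat_finite[OF q(2)] by (auto simp: atLeast0LessThan)
    define u where "u i = L (snd (f i))" for i
    define v where "v i = R (snd (f i))" for i
    have fq: "f i \<in> p" "fst (f i) \<in> N" if "i < card q" for i
    proof -
      have "f i \<in> q" using bij_betwE[OF f] that by blast
      then show "f i \<in> p" "fst (f i) \<in> N" by (auto simp: q_def)
    qed
    have uv: "a \<le> u i \<and> u i \<le> v i \<and> v i \<le> b" "{u i..v i} \<subseteq> U" "snd (f i) = {u i..v i}" if "i < card q" for i
      using LR[of "fst (f i)" "snd (f i)"] fq[OF that] by (auto simp: u_def v_def \<gamma>_def)
    have disj: "disjoint_family_on (\<lambda>i. {u i<..<v i}) {..<card q}"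
    proof (unfold disjoint_family_on_def, intro ballI impI)
      fix i j assume ij: "i \<in> {..<card q}" "j \<in> {..<card q}" "i \<noteq> j"
      have ne: "f i \<noteq> f j" using f ij by (auto simp: bij_betw_def inj_on_def)
      have "interior (snd (f i)) \<inter> interior (snd (f j)) = {}"
        using tagged_division_ofD(5)[OF p(1), of "fst (f i)" "snd (f i)" "fst (f j)" "snd (f j)"]
          fq ij ne by (auto simp: prod_eq_iff)
      then show "{u i<..<v i} \<inter> {u j<..<v j} = {}"
        using uv(3) ij by (simp add: interior_atLeastAtMost_real)
    qed
    have "(\<Sum>i<card q. v i - u i) = (\<Sum>i<card q. measure lebesgue {u i<..<v i})"
      using uv(1) by (intro sum.cong) auto
    also have "\<dots> = measure lebesgue (\<Union>i<card q. {u i<..<v i})"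
      using disj uv(1) by (intro measure_finite_Union[symmetric]) (auto simp: emeasure_lborel_Ioo)
    also have "\<dots> \<le> measure lebesgue U"
    proof (intro measure_mono_fmeasurable U)
      show "(\<Union>i<card q. {u i<..<v i}) \<subseteq> U" using uv(2) by fastforce
    qed auto
    also have "\<dots> < \<delta>" by (rule U)
    finally have "(\<Sum>i<card q. dist (g (u i)) (g (v i))) < \<epsilon>"
      by (intro AC[rule_format] conjI allI impI) (use uv(1) disj in auto)
    moreover have "(\<Sum>(x,k)\<in>q. g (R k) - g (L k)) = (\<Sum>i<card q. g (v i) - g (u i))"
      by (subst sum.reindex_bij_betw[OF f, symmetric]) (simp add: u_def v_def case_prod_beta)
    moreover have "\<dots> \<le> (\<Sum>i<card q. dist (g (u i)) (g (v i)))"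
      by (intro sum_mono) (auto simp: dist_real_def)
    moreover have "g b - g a = (\<Sum>(x,k)\<in>p - q. g (R k) - g (L k)) + (\<Sum>(x,k)\<in>q. g (R k) - g (L k))"
      unfolding tele[of g, symmetric] using q fin by (intro sum.subset_diff)
    ultimately show ?thesis using good by linarith
  qed
  show ?thesis
  proof (rule ccontr)
    assume "\<not> ?thesis"
    then have pos: "g b - g a > 0" by simp
    \<comment> \<open>\<open>est\<close> bounds the increase by
      \<open>\<epsilon> * (b - a + 1)\<close>; this choice makes the bound half of the supposed
      increase. The summand 1 also covers \<open>a = b\<close>.\<close>
    define \<epsilon> where "\<epsilon> = (g b - g a) / (2 * (b - a + 1))"
    have "b - a + 1 > 0" using \<open>a \<le> b\<close> by simp
    then have "\<epsilon> > 0" "\<epsilon> * (b - a + 1) = (g b - g a) / 2"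
      using pos by (auto simp: \<epsilon>_def field_simps)
    then show False using est[of \<epsilon>] pos by (simp add: algebra_simps)
  qed
qed

lemma abs_continuous_on_continuous:
  assumes "abs_continuous_on a b f"
  shows "continuous_on {a..b} f"
  unfolding continuous_on_iff
proof (intro ballI allI impI)
  fix x e :: real assume x: "x \<in> {a..b}" and "e > 0"
  obtain d where "d > 0" and d: "\<forall>(n::nat) u v. (\<forall>i<n. a \<le> u i \<and> u i \<le> v i \<and> v i \<le> b) \<and>
        disjoint_family_on (\<lambda>i. {u i<..<v i}) {..<n} \<and> (\<Sum>i<n. v i - u i) < d
        \<longrightarrow> (\<Sum>i<n. dist (f (u i)) (f (v i))) < e"
    by (rule abs_continuous_onE[OF assms \<open>e > 0\<close>])
  show "\<exists>d>0. \<forall>y\<in>{a..b}. dist y x < d \<longrightarrow> dist (f y) (f x) < e"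
  proof (intro exI[of _ d] conjI ballI impI)
    fix y assume y: "y \<in> {a..b}" "dist y x < d"
    show "dist (f y) (f x) < e"
      using d[rule_format, of 1 "\<lambda>_. min x y" "\<lambda>_. max x y"] x y
      by (cases "x \<le> y") (simp_all add: disjoint_family_on_def dist_real_def dist_commute)
  qed (fact \<open>d > 0\<close>)
qed

text \<open>The term \<open>y - x\<close> admits functions that depend on time explicitly as well as
  through \<open>f\<close>, such as the exponentially weighted energy.\<close>

lemma abs_continuous_on_compare:
  fixes f :: "real \<Rightarrow> 'a::metric_space" and g :: "real \<Rightarrow> 'b::metric_space"
  assumes f: "abs_continuous_on a b f" and "L > 0"
    and le: "\<And>x y. a \<le> x \<Longrightarrow> x \<le> y \<Longrightarrow> y \<le> b \<Longrightarrow>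
               dist (g x) (g y) \<le> L * (dist (f x) (f y) + (y - x))"
  shows "abs_continuous_on a b g"
  unfolding abs_continuous_on_def
proof (intro allI impI)
  fix e :: real assume "e > 0"
  then have e: "e / (2 * L) > 0" using \<open>L > 0\<close> by simp
  obtain d where "d > 0" and d: "\<forall>(n::nat) u v. (\<forall>i<n. a \<le> u i \<and> u i \<le> v i \<and> v i \<le> b) \<and>
        disjoint_family_on (\<lambda>i. {u i<..<v i}) {..<n} \<and> (\<Sum>i<n. v i - u i) < d
        \<longrightarrow> (\<Sum>i<n. dist (f (u i)) (f (v i))) < e / (2 * L)"
    by (rule abs_continuous_onE[OF f e])
  show "\<exists>d>0. \<forall>(n::nat) u v. (\<forall>i<n. a \<le> u i \<and> u i \<le> v i \<and> v i \<le> b) \<and>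
          disjoint_family_on (\<lambda>i. {u i<..<v i}) {..<n} \<and> (\<Sum>i<n. v i - u i) < d
          \<longrightarrow> (\<Sum>i<n. dist (g (u i)) (g (v i))) < e"
  \<comment> \<open>Half of \<open>e\<close> is spent on the variation of \<open>f\<close> and half
    on the total length of the intervals, hence the second bound on that length.\<close>
  proof (intro exI[of _ "min d (e / (2 * L))"] conjI allI impI)
    fix n :: nat and u v
    assume uv: "(\<forall>i<n. a \<le> u i \<and> u i \<le> v i \<and> v i \<le> b) \<and>
          disjoint_family_on (\<lambda>i. {u i<..<v i}) {..<n} \<and> (\<Sum>i<n. v i - u i) < min d (e / (2 * L))"
    then have "(\<Sum>i<n. dist (f (u i)) (f (v i))) < e / (2 * L)" by (intro d[rule_format]) auto
    moreover have "(\<Sum>i<n. dist (g (u i)) (g (v i)))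
        \<le> (\<Sum>i<n. L * (dist (f (u i)) (f (v i)) + (v i - u i)))"
      using uv by (intro sum_mono le) auto
    moreover have "\<dots> = L * ((\<Sum>i<n. dist (f (u i)) (f (v i))) + (\<Sum>i<n. v i - u i))"
      by (simp only: sum_distrib_left sum.distrib distrib_left)
    ultimately have "(\<Sum>i<n. dist (g (u i)) (g (v i))) < L * (e / (2 * L) + e / (2 * L))"
      using uv \<open>L > 0\<close> by (smt (verit, best) mult_strict_left_mono)
    also have "\<dots> = e" using \<open>L > 0\<close> by simp
    finally show "(\<Sum>i<n. dist (g (u i)) (g (v i))) < e" .
  qed (use \<open>d > 0\<close> e in auto)
qed

text \<open>\<open>g\<close> is the squared norm of \<open>z\<close> times an integrating factor, so
  the differential inequality makes its derivative nonpositive off \<open>N\<close>. Absolute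
  continuity of \<open>g\<close> has to be established as well, because the sign of a derivative
  alone does not give monotonicity across a null set.\<close>

lemma energy_decay:
  fixes z :: "real \<Rightarrow> 'a::real_inner"
  assumes "t \<ge> 0" and ac: "abs_continuous_on 0 t z" and N: "negligible N"
    and deriv: "\<And>s. s \<in> {0..t} \<Longrightarrow> s \<notin> N \<Longrightarrow>
      \<exists>d. (z has_vector_derivative d) (at s) \<and> z s \<bullet> d \<le> - \<alpha> * (norm (z s))\<^sup>2"
  shows "norm (z t) \<le> exp (- \<alpha> * t) * norm (z 0)"
proof -
  define g where "g s = (exp (\<alpha> * s) *\<^sub>R z s) \<bullet> (exp (\<alpha> * s) *\<^sub>R z s)" for s
  have cont: "continuous_on {0..t} (\<lambda>s. norm (z s))"
    by (intro continuous_intros abs_continuous_on_continuous ac)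
  have "bounded ((\<lambda>s. norm (z s)) ` {0..t})"
    by (intro compact_imp_bounded compact_continuous_image cont) simp
  then obtain B where "B > 0" and B: "\<And>s. s \<in> {0..t} \<Longrightarrow> norm (z s) \<le> B"
    by (auto simp: bounded_pos)
  \<comment> \<open>\<alpha> may have either sign; with its absolute value, \<open>E\<close> bounds
    the weight on the whole interval and is at least 1 in both cases.\<close>
  define E where "E = exp (\<bar>\<alpha>\<bar> * t)"
  have E: "exp (\<alpha> * s) \<le> E" "E \<ge> 1" if "s \<in> {0..t}" for s
  proof -
    have "\<alpha> * s \<le> \<bar>\<alpha>\<bar> * t" using that
      by (smt (verit, best) abs_ge_self atLeastAtMost_iff mult_left_mono mult_right_mono)
    then show "exp (\<alpha> * s) \<le> E" by (simp add: E_def)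
    show "E \<ge> 1" using \<open>t \<ge> 0\<close> by (simp add: E_def)
  qed
  have expL: "\<bar>exp (\<alpha> * x) - exp (\<alpha> * y)\<bar> \<le> \<bar>\<alpha>\<bar> * E * (y - x)" if "0 \<le> x" "x \<le> y" "y \<le> t" for x y
  proof (cases "x = y")
    case False
    then have "x < y" using that by simp
    have "\<exists>s>x. s < y \<and> exp (\<alpha> * y) - exp (\<alpha> * x) = (y - x) * (\<alpha> * exp (\<alpha> * s))"
      by (rule MVT2[OF \<open>x < y\<close>]) (auto intro!: derivative_eq_intros)
    then obtain s where "s > x" "s < y" "exp (\<alpha> * y) - exp (\<alpha> * x) = (y - x) * (\<alpha> * exp (\<alpha> * s))"
      by blast
    then have "\<bar>exp (\<alpha> * x) - exp (\<alpha> * y)\<bar> = (y - x) * (\<bar>\<alpha>\<bar> * exp (\<alpha> * s))"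
      using that \<open>x < y\<close> by (subst abs_minus_commute) (simp add: abs_mult)
    also have "\<dots> \<le> (y - x) * (\<bar>\<alpha>\<bar> * E)"
      using that E(1)[of s] \<open>s > x\<close> \<open>s < y\<close> by (intro mult_left_mono) auto
    finally show ?thesis by (simp add: algebra_simps)
  qed simp
  have "E \<ge> 1" using E(2)[of 0] \<open>t \<ge> 0\<close> by simp
  have wL: "norm (exp (\<alpha> * x) *\<^sub>R z x - exp (\<alpha> * y) *\<^sub>R z y) \<le> E * dist (z x) (z y) + \<bar>\<alpha>\<bar> * E * B * (y - x)"
    if "0 \<le> x" "x \<le> y" "y \<le> t" for x y
  proof -
    have "exp (\<alpha> * x) *\<^sub>R z x - exp (\<alpha> * y) *\<^sub>R z y =
      exp (\<alpha> * x) *\<^sub>R (z x - z y) + (exp (\<alpha> * x) - exp (\<alpha> * y)) *\<^sub>R z y"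
      by (simp add: algebra_simps)
    then have "norm (exp (\<alpha> * x) *\<^sub>R z x - exp (\<alpha> * y) *\<^sub>R z y) \<le>
      exp (\<alpha> * x) * dist (z x) (z y) + \<bar>exp (\<alpha> * x) - exp (\<alpha> * y)\<bar> * norm (z y)"
      by (metis abs_exp_cancel dist_norm norm_scaleR norm_triangle_ineq)
    also have "\<dots> \<le> E * dist (z x) (z y) + (\<bar>\<alpha>\<bar> * E * (y - x)) * B"
      using that E(1)[of x] expL[OF that] B[of y] \<open>E \<ge> 1\<close> \<open>B > 0\<close>
      by (intro add_mono mult_mono) auto
    finally show ?thesis by (simp add: algebra_simps)
  qed
  have wB: "norm (exp (\<alpha> * x) *\<^sub>R z x) \<le> E * B" if "x \<in> {0..t}" for x
    using E(1)[OF that] B[OF that] \<open>E \<ge> 1\<close> by (simp add: mult_mono)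
  have "abs_continuous_on 0 t g"
  proof (rule abs_continuous_on_compare[OF ac])
    \<comment> \<open>The difference of two squared norms is the inner product of the difference
      with the sum: \<open>2 * E * B\<close> bounds the sum, and the bracket collects both terms of
      \<open>wL\<close>.\<close>
    show "2 * E * B * (E + \<bar>\<alpha>\<bar> * E * B) > 0"
      using \<open>E \<ge> 1\<close> \<open>B > 0\<close> by (intro mult_pos_pos add_pos_nonneg) auto
    fix x y assume xy: "0 \<le> x" "x \<le> y" "y \<le> t"
    let ?w = "\<lambda>x. exp (\<alpha> * x) *\<^sub>R z x"
    have "u \<bullet> u - v \<bullet> v = (u - v) \<bullet> (u + v)" for u v :: 'a
      by (simp add: inner_add_right inner_diff_left) (simp add: inner_diff_right inner_commute)
    then have "g x - g y = (?w x - ?w y) \<bullet> (?w x + ?w y)"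
      unfolding g_def .
    then have "dist (g x) (g y) \<le> norm (?w x - ?w y) * norm (?w x + ?w y)"
      by (metis Cauchy_Schwarz_ineq2 dist_real_def)
    also have "\<dots> \<le> (E * dist (z x) (z y) + \<bar>\<alpha>\<bar> * E * B * (y - x)) * (E * B + E * B)"
      using wL[OF xy] wB[of x] wB[of y] xy \<open>E \<ge> 1\<close> \<open>B > 0\<close>
      by (intro mult_mono norm_triangle_mono) auto
    also have "\<dots> \<le> ((E + \<bar>\<alpha>\<bar> * E * B) * (dist (z x) (z y) + (y - x))) * (E * B + E * B)"
    proof (intro mult_right_mono)
      have "0 \<le> E * (y - x)" "0 \<le> \<bar>\<alpha>\<bar> * E * B * dist (z x) (z y)"
        using xy \<open>E \<ge> 1\<close> \<open>B > 0\<close> by auto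
      then show "E * dist (z x) (z y) + \<bar>\<alpha>\<bar> * E * B * (y - x)
          \<le> (E + \<bar>\<alpha>\<bar> * E * B) * (dist (z x) (z y) + (y - x))"
        unfolding distrib_left distrib_right by linarith
    qed (use \<open>E \<ge> 1\<close> \<open>B > 0\<close> in auto)
    finally show "dist (g x) (g y) \<le> 2 * E * B * (E + \<bar>\<alpha>\<bar> * E * B) * (dist (z x) (z y) + (y - x))"
      by (simp add: algebra_simps)
  qed
  then have "g t \<le> g 0"
  proof (rule abs_continuous_on_deriv_nonpos[OF \<open>t \<ge> 0\<close> _ N])
    fix s assume s: "s \<in> {0..t}" "s \<notin> N"
    then obtain d where d: "(z has_vector_derivative d) (at s)" "z s \<bullet> d \<le> - \<alpha> * (norm (z s))\<^sup>2"
      using deriv by blast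
    define w' where "w' = exp (\<alpha> * s) *\<^sub>R d + (\<alpha> * exp (\<alpha> * s)) *\<^sub>R z s"
    have "((\<lambda>s. exp (\<alpha> * s)) has_real_derivative \<alpha> * exp (\<alpha> * s)) (at s)"
      by (auto intro!: derivative_eq_intros)
    from has_vector_derivative_scaleR[OF this d(1)]
    have w': "((\<lambda>s. exp (\<alpha> * s) *\<^sub>R z s) has_vector_derivative w') (at s)"
      by (simp add: w'_def)
    then have "(g has_derivative (\<lambda>h. (exp (\<alpha> * s) *\<^sub>R z s) \<bullet> (h *\<^sub>R w') + (h *\<^sub>R w') \<bullet> (exp (\<alpha> * s) *\<^sub>R z s))) (at s)"
      unfolding g_def has_vector_derivative_def by (intro has_derivative_inner)
    then have "(g has_real_derivative 2 * ((exp (\<alpha> * s) *\<^sub>R z s) \<bullet> w')) (at s)"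
      unfolding has_field_derivative_def
      by (rule has_derivative_eq_rhs) (auto simp: inner_commute algebra_simps)
    moreover have "2 * ((exp (\<alpha> * s) *\<^sub>R z s) \<bullet> w') \<le> 0"
    proof -
      have "(exp (\<alpha> * s) *\<^sub>R z s) \<bullet> w' = (exp (\<alpha> * s))\<^sup>2 * (z s \<bullet> d + \<alpha> * (norm (z s))\<^sup>2)"
      unfolding power2_norm_eq_inner
      by (simp add: w'_def inner_add_right power2_eq_square algebra_simps)
      also have "\<dots> \<le> 0" using d(2) by (intro mult_nonneg_nonpos) auto
      finally show ?thesis by linarith
    qed
    ultimately show "\<exists>d\<le>0. (g has_real_derivative d) (at s)" by blast
  qed
  then have "(exp (\<alpha> * t) * norm (z t))\<^sup>2 \<le> (norm (z 0))\<^sup>2"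
    unfolding power_mult_distrib power2_norm_eq_inner by (simp add: g_def power2_eq_square algebra_simps)
  then have "exp (\<alpha> * t) * norm (z t) \<le> norm (z 0)"
    by (rule power2_le_imp_le) simp
  then have "exp (- \<alpha> * t) * (exp (\<alpha> * t) * norm (z t)) \<le> exp (- \<alpha> * t) * norm (z 0)"
    by (intro mult_left_mono) auto
  then show ?thesis by (simp add: mult.assoc[symmetric] exp_add[symmetric])
qed

subsection \<open>The smallest eigenvalue\<close>

lemma symmetric_matrix_inner:
  fixes A :: "real^'n^'n"
  assumes "transpose A = A"
  shows "x \<bullet> (A *v y) = (A *v x) \<bullet> y"
  by (metis assms dot_lmul_matrix vector_transpose_matrix)

text \<open>Eigenvectors to distinct eigenvalues are orthogonal, hence independent. Finiteness is
  what makes \<open>Min\<close> in \<open>lambda_min\<close> a lower bound of the spectrum.\<close>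

lemma finite_eigenvalues:
  fixes A :: "real^'n^'n"
  assumes A: "transpose A = A"
  shows "finite (eigenvalues A)"
proof -
  have "\<forall>l\<in>eigenvalues A. \<exists>x. x \<noteq> 0 \<and> A *v x = l *\<^sub>R x" by (auto simp: eigenvalues_def)
  then obtain f where f: "\<And>l. l \<in> eigenvalues A \<Longrightarrow> f l \<noteq> 0 \<and> A *v f l = l *\<^sub>R f l"
    by metis
  have orth: "f l \<bullet> f m = 0" if "l \<in> eigenvalues A" "m \<in> eigenvalues A" "l \<noteq> m" for l m
  proof -
    have "m * (f l \<bullet> f m) = l * (f l \<bullet> f m)"
      using symmetric_matrix_inner[OF A, of "f l" "f m"] f[OF that(1)] f[OF that(2)] by simp
    then show ?thesis using that(3) by simp
  qed
  have inj: "inj_on f (eigenvalues A)"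
    using orth f by (metis inj_onI inner_eq_zero_iff)
  have "pairwise orthogonal (f ` eigenvalues A)"
    using orth by (auto simp: pairwise_def orthogonal_def)
  moreover have "0 \<notin> f ` eigenvalues A" using f by auto
  ultimately have "independent (f ` eigenvalues A)"
    by (rule pairwise_orthogonal_independent)
  then have "finite (f ` eigenvalues A)"
    using independent_bound by blast
  then show ?thesis using inj by (rule finite_imageD)
qed

text \<open>Compactness of the unit sphere provides a minimiser \<open>e\<close> of the quadratic
  form. Its value is an eigenvalue, hence at least \<open>lambda_min A\<close>, and by homogeneity
  it bounds the form from below everywhere.\<close>

lemma lambda_min_le_Rayleigh:
  fixes A :: "real^'n^'n"
  assumes A: "transpose A = A"
  shows "lambda_min A * (norm x)\<^sup>2 \<le> x \<bullet> (A *v x)"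
proof -
  define q where "q x = x \<bullet> (A *v x)" for x
  have cont: "continuous_on (sphere 0 1) q"
    unfolding q_def by (intro continuous_intros linear_continuous_on matrix_vector_mul_bounded_linear)
  have "sphere (0::real^'n) 1 \<noteq> {}" by simp
  then obtain e where e: "norm e = 1" and min: "\<And>y. norm y = 1 \<Longrightarrow> q e \<le> q y"
    using continuous_attains_inf[OF compact_sphere _ cont] by auto
  define m where "m = q e"
  have ge: "m * (norm y)\<^sup>2 \<le> q y" for y
  proof (cases "y = 0")
    case False
    have "m \<le> q ((1 / norm y) *\<^sub>R y)"
      unfolding m_def using False by (intro min) simp
    also have "\<dots> = q y / (norm y)\<^sup>2"
      using False by (simp add: q_def scaleR_matrix_vector_assoc[symmetric] matrix_vector_mult_scaleR power2_eq_square)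
    finally show ?thesis using False by (simp add: field_simps)
  qed (simp add: q_def)
  have "A *v e = m *\<^sub>R e"
  proof -
    define r where "r = A *v e - m *\<^sub>R e"
    \<comment> \<open>The form \<open>q - m |\<cdot>|\<^sup>2\<close> is nonnegative and vanishes at \<open>e\<close>, so its derivative there does too.\<close>
    have pos: "0 \<le> s * (2 * (r \<bullet> r) + s * (q r - m * (norm r)\<^sup>2))" for s
    proof -
      have "q (e + s *\<^sub>R r) = q e + 2 * s * (r \<bullet> (A *v e)) + s\<^sup>2 * q r"
        using symmetric_matrix_inner[OF A, of e r]
        by (simp add: q_def matrix_vector_right_distrib matrix_vector_mult_scaleR inner_add_left inner_add_right
            inner_commute power2_eq_square algebra_simps)
      moreover have "(norm (e + s *\<^sub>R r))\<^sup>2 = 1 + 2 * s * (r \<bullet> e) + s\<^sup>2 * (norm r)\<^sup>2"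
        using e unfolding power2_norm_eq_inner norm_eq_1
        by (simp add: inner_add_left inner_add_right inner_commute power2_eq_square algebra_simps)
      ultimately have "0 \<le> 2 * s * (r \<bullet> (A *v e)) + s\<^sup>2 * q r - m * (2 * s * (r \<bullet> e) + s\<^sup>2 * (norm r)\<^sup>2)"
        using ge[of "e + s *\<^sub>R r"] by (simp add: m_def algebra_simps)
      also have "\<dots> = s * (2 * (r \<bullet> r) + s * (q r - m * (norm r)\<^sup>2))"
        by (simp add: r_def inner_diff_right power2_eq_square algebra_simps)
      finally show ?thesis .
    qed
    define D where "D = q r - m * (norm r)\<^sup>2"
    have D: "D \<ge> 0" using ge[of r] by (simp add: D_def)
    have "r \<bullet> r = 0"
    proof (rule ccontr)
      assume "r \<bullet> r \<noteq> 0"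
      then have rr: "r \<bullet> r > 0" by (simp add: less_le)
      \<comment> \<open>A negative \<open>s\<close> of this size keeps \<open>s * D\<close> above
        \<open>- (r \<bullet> r)\<close>, which makes the product in \<open>pos\<close> negative;
        \<open>D + 1\<close> keeps the denominator positive even for \<open>D = 0\<close>.\<close>
      define s where "s = - (r \<bullet> r) / (D + 1)"
      have "s < 0" using rr D by (simp add: s_def field_simps)
      moreover have "s * D \<ge> - (r \<bullet> r)"
        using rr D by (simp add: s_def field_simps)
      then have "2 * (r \<bullet> r) + s * D > 0" using rr by linarith
      ultimately have "s * (2 * (r \<bullet> r) + s * D) < 0" by (rule mult_neg_pos)
      then show False using pos[of s] by (simp add: D_def)
    qed
    then show ?thesis by (simp add: r_def)
  qed
  then have "m \<in> eigenvalues A" using e by (auto simp: eigenvalues_def intro!: exI[of _ e])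
  then have "lambda_min A \<le> m"
    unfolding lambda_min_def by (intro Min_le finite_eigenvalues A)
  then have "lambda_min A * (norm x)\<^sup>2 \<le> m * (norm x)\<^sup>2" by (intro mult_right_mono) auto
  also have "\<dots> \<le> x \<bullet> (A *v x)" using ge[of x] by (simp add: q_def)
  finally show ?thesis .
qed

subsection \<open>Square-integrable functions\<close>

text \<open>Periodicity, a part of \<open>torus_L2\<close>, is left out: some approximations
  constructed below are meaningful on the period cell alone.\<close>

definition square_integrable :: "'a measure \<Rightarrow> ('a \<Rightarrow> 'b::euclidean_space) \<Rightarrow> bool" where
  "square_integrable M f \<longleftrightarrow> f \<in> borel_measurable M \<and> integrable M (\<lambda>x. (norm (f x))\<^sup>2)"

lemma square_integrable_measurable [measurable_dest]:
  "square_integrable M f \<Longrightarrow> f \<in> borel_measurable M"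
  by (simp add: square_integrable_def)

lemma square_integrable_bound:
  assumes "square_integrable M f" "g \<in> borel_measurable M" "\<And>x. x \<in> space M \<Longrightarrow> norm (g x) \<le> norm (f x)"
  shows "square_integrable M g"
proof -
  have "integrable M (\<lambda>x. (norm (g x))\<^sup>2)"
  proof (rule Bochner_Integration.integrable_bound)
    show "integrable M (\<lambda>x. (norm (f x))\<^sup>2)" using assms by (simp add: square_integrable_def)
  qed (use assms in \<open>auto intro: power_mono\<close>)
  then show ?thesis using assms by (simp add: square_integrable_def)
qed

lemma norm_add_power2_le:
  "(norm (a + b))\<^sup>2 \<le> 2 * (norm a)\<^sup>2 + 2 * (norm b)\<^sup>2" for a b :: "'a::real_normed_vector"
proof -
  have "(norm (a + b))\<^sup>2 \<le> (norm a + norm b)\<^sup>2"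
    by (intro power_mono norm_triangle_ineq) auto
  also have "\<dots> \<le> 2 * (norm a)\<^sup>2 + 2 * (norm b)\<^sup>2"
    using sum_squares_bound[of "norm a" "norm b"] by (simp add: power2_sum)
  finally show ?thesis .
qed

lemma square_integrable_add:
  assumes "square_integrable M f" "square_integrable M g"
  shows "square_integrable M (\<lambda>x. f x + g x)"
proof -
  have [measurable]: "f \<in> borel_measurable M" "g \<in> borel_measurable M"
    using assms by (auto simp: square_integrable_def)
  have "integrable M (\<lambda>x. (norm (f x + g x))\<^sup>2)"
  proof (rule Bochner_Integration.integrable_bound)
    show "integrable M (\<lambda>x. 2 * (norm (f x))\<^sup>2 + 2 * (norm (g x))\<^sup>2)"
      using assms by (simp add: square_integrable_def)
    show "AE x in M. norm ((norm (f x + g x))\<^sup>2) \<le> norm (2 * (norm (f x))\<^sup>2 + 2 * (norm (g x))\<^sup>2)"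
      by (intro always_eventually allI) (use norm_add_power2_le[of "f _" "g _"] in \<open>auto intro: order_trans[OF _ abs_ge_self]\<close>)
  qed measurable
  then show ?thesis by (simp add: square_integrable_def)
qed

lemma square_integrable_scaleR:
  assumes "square_integrable M f"
  shows "square_integrable M (\<lambda>x. c *\<^sub>R f x)"
  using assms by (auto simp: square_integrable_def power_mult_distrib)

lemma square_integrable_diff:
  assumes "square_integrable M f" "square_integrable M g"
  shows "square_integrable M (\<lambda>x. f x - g x)"
  using square_integrable_add[OF assms(1) square_integrable_scaleR[OF assms(2), of "-1"]] by simp

lemma square_integrable_zero: "square_integrable M (\<lambda>x. 0)"
  by (simp add: square_integrable_def)

lemma square_integrable_sum:
  "(\<And>i. i \<in> I \<Longrightarrow> square_integrable M (f i)) \<Longrightarrow> square_integrable M (\<lambda>x. \<Sum>i\<in>I. f i x)"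
  by (induction I rule: infinite_finite_induct)
     (auto intro: square_integrable_zero square_integrable_add)

lemma square_integrable_prod_integrable:
  assumes "square_integrable M f" "square_integrable M g"
  shows "integrable M (\<lambda>x. norm (f x) * norm (g x))"
proof (rule Bochner_Integration.integrable_bound)
  show "integrable M (\<lambda>x. (norm (f x))\<^sup>2 + (norm (g x))\<^sup>2)"
    using assms by (simp add: square_integrable_def)
  have "norm (f x) * norm (g x) \<le> (norm (f x))\<^sup>2 + (norm (g x))\<^sup>2" for x
  proof -
    have "0 \<le> norm (f x) * norm (g x)" by simp
    then show ?thesis using sum_squares_bound[of "norm (f x)" "norm (g x)"] by linarith
  qed
  then show "AE x in M. norm (norm (f x) * norm (g x)) \<le> norm ((norm (f x))\<^sup>2 + (norm (g x))\<^sup>2)"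
    by simp
qed (use assms in \<open>auto simp: square_integrable_def\<close>)

lemma square_integrable_integrable:
  fixes h :: "'a \<Rightarrow> 'b::{banach, second_countable_topology}"
  assumes "square_integrable M f" "square_integrable M g" "h \<in> borel_measurable M"
    "\<And>x. x \<in> space M \<Longrightarrow> norm (h x) \<le> norm (f x) * norm (g x)"
  shows "integrable M h"
  by (rule Bochner_Integration.integrable_bound[OF square_integrable_prod_integrable[OF assms(1,2)] assms(3)])
     (use assms(4) in auto)

lemma square_integrable_mult_integrable:
  fixes f g :: "'a \<Rightarrow> real"
  assumes "square_integrable M f" "square_integrable M g"
  shows "integrable M (\<lambda>x. f x * g x)"
  by (rule square_integrable_integrable[OF assms])
     (use assms in \<open>auto simp: square_integrable_def abs_mult\<close>)

text \<open>Integrating the square of \<open>f x - t * g x\<close> gives a quadratic in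
  \<open>t\<close> that is never negative, which bounds its discriminant.\<close>

lemma Cauchy_Schwarz_integral:
  fixes f g :: "'a \<Rightarrow> real"
  assumes f: "square_integrable M f" and g: "square_integrable M g"
  shows "\<bar>LINT x|M. f x * g x\<bar> \<le> sqrt (LINT x|M. (f x)\<^sup>2) * sqrt (LINT x|M. (g x)\<^sup>2)"
proof -
  define A B D where "A = (LINT x|M. (f x)\<^sup>2)" and "B = (LINT x|M. f x * g x)" and "D = (LINT x|M. (g x)\<^sup>2)"
  have int: "integrable M (\<lambda>x. (f x)\<^sup>2)" "integrable M (\<lambda>x. (g x)\<^sup>2)" "integrable M (\<lambda>x. f x * g x)"
    using f g by (auto simp: square_integrable_def intro: square_integrable_mult_integrable)
  have q: "0 \<le> A - 2 * t * B + t\<^sup>2 * D" for t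
  proof -
    have "0 \<le> (LINT x|M. (f x - t * g x)\<^sup>2)" by simp
    also have "\<dots> = (LINT x|M. (f x)\<^sup>2 - 2 * t * (f x * g x) + t\<^sup>2 * (g x)\<^sup>2)"
      by (simp add: power2_diff power_mult_distrib algebra_simps)
    also have "\<dots> = A - 2 * t * B + t\<^sup>2 * D"
      using int by (simp add: A_def B_def D_def)
    finally show ?thesis .
  qed
  have D0: "D \<ge> 0" and A0: "A \<ge> 0" by (auto simp: A_def D_def)
  have "B\<^sup>2 \<le> A * D"
  proof (cases "D = 0")
    case True
    have "B = 0"
    proof (rule ccontr)
      assume "B \<noteq> 0"
      \<comment> \<open>With \<open>D = 0\<close> the quadratic is affine in \<open>t\<close>, and
        it takes the value -1 here.\<close>
      then show False using q[of "(A + 1) / (2 * B)"] True by (simp add: field_simps)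
    qed
    then show ?thesis using True by simp
  next
    case False
    \<comment> \<open>\<open>B / D\<close> is the minimiser of the quadratic.\<close>
    then have "A - 2 * (B / D) * B + (B / D)\<^sup>2 * D = (A * D - B\<^sup>2) / D"
      by (simp add: field_simps power2_eq_square)
    then have "0 \<le> (A * D - B\<^sup>2) / D" using q[of "B / D"] by simp
    then show ?thesis using False D0 by (simp add: zero_le_divide_iff)
  qed
  then have "sqrt (B\<^sup>2) \<le> sqrt (A * D)" by (rule real_sqrt_le_mono)
  then show ?thesis by (simp add: A_def B_def D_def real_sqrt_mult)
qed

lemma sq_integral_add_le:
  fixes f g :: "'a \<Rightarrow> 'b::euclidean_space"
  assumes f: "square_integrable M f" and g: "square_integrable M g"
  shows "(LINT x|M. (norm (f x + g x))\<^sup>2) \<le> 2 * (LINT x|M. (norm (f x))\<^sup>2) + 2 * (LINT x|M. (norm (g x))\<^sup>2)"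
proof -
  have "(LINT x|M. (norm (f x + g x))\<^sup>2) \<le> (LINT x|M. 2 * (norm (f x))\<^sup>2 + 2 * (norm (g x))\<^sup>2)"
  proof (rule integral_mono)
    show "integrable M (\<lambda>x. (norm (f x + g x))\<^sup>2)"
      using square_integrable_add[OF f g] by (simp add: square_integrable_def)
    show "integrable M (\<lambda>x. 2 * (norm (f x))\<^sup>2 + 2 * (norm (g x))\<^sup>2)"
      using f g by (simp add: square_integrable_def)
    show "(norm (f x + g x))\<^sup>2 \<le> 2 * (norm (f x))\<^sup>2 + 2 * (norm (g x))\<^sup>2" for x
      by (rule norm_add_power2_le)
  qed
  also have "\<dots> = 2 * (LINT x|M. (norm (f x))\<^sup>2) + 2 * (LINT x|M. (norm (g x))\<^sup>2)"
    using f g by (simp add: square_integrable_def)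
  finally show ?thesis .
qed

text \<open>The product is expanded around the limits, so that each error term pairs a small
  difference with a fixed function or with another small difference, and Cauchy-Schwarz applies to
  each.\<close>

lemma tendsto_integral_mult:
  fixes f g :: "'a \<Rightarrow> real"
  assumes sq: "square_integrable M f" "square_integrable M g"
      "\<And>n::nat. square_integrable M (u n)" "\<And>n. square_integrable M (v n)"
    and u: "(\<lambda>n. LINT x|M. (f x - u n x)\<^sup>2) \<longlonglongrightarrow> 0" and v: "(\<lambda>n. LINT x|M. (g x - v n x)\<^sup>2) \<longlonglongrightarrow> 0"
  shows "(\<lambda>n. LINT x|M. u n x * v n x) \<longlonglongrightarrow> (LINT x|M. f x * g x)"
proof -
  define A where "A n = sqrt (LINT x|M. (f x - u n x)\<^sup>2)" for n
  define B where "B n = sqrt (LINT x|M. (g x - v n x)\<^sup>2)" for n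
  define F where "F = sqrt (LINT x|M. (f x)\<^sup>2)"
  define G where "G = sqrt (LINT x|M. (g x)\<^sup>2)"
  have "A \<longlonglongrightarrow> sqrt 0" "B \<longlonglongrightarrow> sqrt 0"
    unfolding A_def B_def by (intro tendsto_intros u v)+
  then have "(\<lambda>n. A n * B n + A n * G + F * B n) \<longlonglongrightarrow> 0 * 0 + 0 * G + F * 0"
    by (intro tendsto_intros) auto
  then have lim: "(\<lambda>n. A n * B n + A n * G + F * B n) \<longlonglongrightarrow> 0" by simp
  have "\<bar>(LINT x|M. u n x * v n x) - (LINT x|M. f x * g x)\<bar> \<le> A n * B n + A n * G + F * B n" for n
  proof -
    note d = square_integrable_diff[OF sq(1) sq(3)[of n]] square_integrable_diff[OF sq(2) sq(4)[of n]]
    note int = square_integrable_mult_integrable[OF d] square_integrable_mult_integrable[OF d(1) sq(2)]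
      square_integrable_mult_integrable[OF sq(1) d(2)] square_integrable_mult_integrable[OF sq(1,2)]
    have "(LINT x|M. u n x * v n x) = (LINT x|M. ((f x - u n x) * (g x - v n x) - (f x - u n x) * g x
        - f x * (g x - v n x)) + f x * g x)"
      by (simp add: algebra_simps)
    also have "\<dots> = (LINT x|M. (f x - u n x) * (g x - v n x)) - (LINT x|M. (f x - u n x) * g x)
        - (LINT x|M. f x * (g x - v n x)) + (LINT x|M. f x * g x)"
      using int by (simp del: Bochner_Integration.integral_mult_left Bochner_Integration.integral_mult_right)
    finally show ?thesis
      using Cauchy_Schwarz_integral[OF d] Cauchy_Schwarz_integral[OF d(1) sq(2)]
        Cauchy_Schwarz_integral[OF sq(1) d(2)]
      unfolding A_def B_def F_def G_def by linarith
  qed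
  then have "(\<lambda>n. (LINT x|M. u n x * v n x) - (LINT x|M. f x * g x)) \<longlonglongrightarrow> 0"
    by (intro Lim_null_comparison[OF _ lim] always_eventually) auto
  then show ?thesis by (simp add: LIM_zero_iff)
qed

text \<open>Integrability of the limit is a conclusion: a uniform bound on partial sums is to be
  carried over to a function not yet known to have a finite fourth-power integral.\<close>

lemma Fatou_integral_le:
  fixes u :: "nat \<Rightarrow> 'a \<Rightarrow> real"
  assumes int: "\<And>n. integrable M (u n)" and nn: "\<And>n x. 0 \<le> u n x"
    and f: "f \<in> borel_measurable M" and lim: "AE x in M. (\<lambda>n. u n x) \<longlonglongrightarrow> f x"
    and le: "\<And>n. (LINT x|M. u n x) \<le> B"
  shows "integrable M f" "(LINT x|M. f x) \<le> B"
proof -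
  have "B \<ge> 0" using le[of 0] nn by (meson Bochner_Integration.integral_nonneg order_trans)
  have f0: "AE x in M. 0 \<le> f x"
    using lim by eventually_elim (rule LIMSEQ_le_const, auto simp: nn)
  have "(\<integral>\<^sup>+x. ennreal (f x) \<partial>M) = (\<integral>\<^sup>+x. liminf (\<lambda>n. ennreal (u n x)) \<partial>M)"
  proof (rule nn_integral_cong_AE)
    show "AE x in M. ennreal (f x) = liminf (\<lambda>n. ennreal (u n x))"
      using lim
    proof eventually_elim
      case (elim x)
      then have "(\<lambda>n. ennreal (u n x)) \<longlonglongrightarrow> ennreal (f x)" by (rule tendsto_ennrealI)
      then show ?case by (simp add: lim_imp_Liminf)
    qed
  qed
  also have "\<dots> \<le> liminf (\<lambda>n. \<integral>\<^sup>+x. ennreal (u n x) \<partial>M)"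
    using int by (intro nn_integral_liminf) auto
  also have "\<dots> \<le> liminf (\<lambda>n. ennreal B)"
    using int nn le by (intro Liminf_mono always_eventually) (auto simp: nn_integral_eq_integral intro!: ennreal_leI)
  also have "\<dots> = ennreal B" by (simp add: Liminf_const)
  finally have *: "(\<integral>\<^sup>+x. ennreal (f x) \<partial>M) \<le> ennreal B" .
  then show i: "integrable M f"
    using f f0 by (intro integrableI_nonneg) (auto simp: order_le_less_trans)
  show "(LINT x|M. f x) \<le> B"
    using * f0 \<open>B \<ge> 0\<close> by (simp add: nn_integral_eq_integral[OF i])
qed

subsection \<open>Fourier modes on the torus\<close>

text \<open>\<open>lborel\<close> is the image of a product measure under assembling the
  coordinates, so the integral of a separated integrand factorises.\<close>

lemma integral_lborel_prod:
  fixes f :: "'a::euclidean_space \<Rightarrow> real \<Rightarrow> complex"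
  assumes "\<And>b. b \<in> Basis \<Longrightarrow> integrable lborel (f b)"
  shows "(LINT x|lborel. (\<Prod>b\<in>Basis. f b (x \<bullet> b))) = (\<Prod>b\<in>Basis. LINT y|lborel. f b y)"
proof -
  interpret product_sigma_finite "\<lambda>_::'a. lborel :: real measure" ..
  have [measurable]: "f b \<in> borel_measurable borel" if "b \<in> Basis" for b
    using borel_measurable_integrable[OF assms[OF that]] by simp
  have "(LINT x|lborel. (\<Prod>b\<in>Basis. f b (x \<bullet> b))) =
     (LINT g|(\<Pi>\<^sub>M b\<in>Basis. lborel). (\<Prod>b\<in>Basis. f b ((\<Sum>b\<in>Basis. g b *\<^sub>R b) \<bullet> b)))"
    by (subst lborel_eq) (simp add: integral_distr)
  also have "\<dots> = (LINT g|(\<Pi>\<^sub>M b\<in>Basis. lborel). (\<Prod>b\<in>Basis. f b (g b)))"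
    by (intro Bochner_Integration.integral_cong refl prod.cong) auto
  also have "\<dots> = (\<Prod>b\<in>Basis. LINT y|lborel. f b y)"
    by (rule product_integral_prod) (auto intro: assms)
  finally show ?thesis .
qed

section \<open>The unit cell as a probability space\<close>

lemma space_torus [simp]: "space torus = cbox 0 1"
  by (simp add: torus_def)

lemma emeasure_torus: "emeasure torus (space torus) = 1"
proof -
  have "(\<Prod>b\<in>(Basis::(real^3) set). (1::real^3) \<bullet> b) = 1"
    by (intro prod.neutral) (auto simp: Basis_vec_def inner_axis)
  moreover have "\<forall>b\<in>Basis. (0::real^3) \<bullet> b \<le> 1 \<bullet> b"
    by (auto simp: Basis_vec_def inner_axis)
  ultimately show ?thesis
    by (simp add: torus_def emeasure_restrict_space emeasure_lborel_cbox_eq)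
qed

interpretation torus: finite_measure torus
  by (rule finite_measureI) (use emeasure_torus in auto)

lemma measure_torus [simp]: "measure torus (cbox 0 1) = 1"
  using emeasure_torus by (simp add: measure_def)

lemma borel_measurable_torusI:
  fixes f :: "real^3 \<Rightarrow> 'b::euclidean_space"
  assumes "continuous_on UNIV f"
  shows "f \<in> borel_measurable torus"
  unfolding torus_def
  by (intro continuous_imp_measurable_on_sets_lebesgue continuous_on_subset[OF assms]) auto

lemma continuous_integrable_torus:
  fixes f :: "real^3 \<Rightarrow> 'b::euclidean_space"
  assumes "continuous_on UNIV f"
  shows "integrable torus f"
proof -
  have "compact (f ` cbox 0 1)"
    by (intro compact_continuous_image continuous_on_subset[OF assms]) auto
  then obtain B where B: "\<And>x. x \<in> cbox 0 1 \<Longrightarrow> norm (f x) \<le> B"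
    by (meson bounded_iff compact_imp_bounded imageI)
  show ?thesis
    by (rule torus.integrable_const_bound[of _ B])
       (use B borel_measurable_torusI[OF assms] in auto)
qed

lemma continuous_square_integrable_torus:
  fixes f :: "real^3 \<Rightarrow> 'b::euclidean_space"
  assumes "continuous_on UNIV f"
  shows "square_integrable torus f"
  unfolding square_integrable_def
  by (intro conjI borel_measurable_torusI continuous_integrable_torus continuous_intros assms)

lemma integral_torus:
  fixes f :: "real^3 \<Rightarrow> complex"
  assumes "continuous_on UNIV f"
  shows "(LINT x|torus. f x) = (LINT x|lborel. indicator (cbox 0 1) x *\<^sub>R f x)"
proof -
  have [measurable]: "f \<in> borel_measurable borel"
    using assms by (rule borel_measurable_continuous_onI)
  show ?thesis
    unfolding torus_def by (subst integral_restrict_space) (auto intro!: integral_completion)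
qed

section \<open>The exponential modes and their orthogonality\<close>

definition mode :: "int^3 \<Rightarrow> real^3 \<Rightarrow> complex" where
  "mode k x = cis (2 * pi * (\<Sum>i\<in>UNIV. of_int (k $ i) * x $ i))"

lemma mode_zero [simp]: "mode 0 x = 1"
  by (simp add: mode_def)

lemma mode_add: "mode (k + l) x = mode k x * mode l x"
  by (simp add: mode_def cis_mult algebra_simps sum.distrib)

lemma cnj_mode: "cnj (mode k x) = mode (- k) x"
  by (simp add: mode_def cis_cnj sum_negf)

lemma mode_shift: "mode k (x + axis j 1) = mode k x"
proof -
  have "(\<Sum>i\<in>UNIV. of_int (k $ i) * (x + axis j 1) $ i) = (\<Sum>i\<in>UNIV. of_int (k $ i) * x $ i) + (of_int (k $ j) :: real)"
    by (simp add: distrib_left sum.distrib) (simp add: axis_def if_distrib cong: if_cong)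
  moreover have "cis (2 * pi * (s + of_int n)) = cis (2 * pi * s)" for s n
  proof -
    have "cis (2 * pi * (s + of_int n)) = cis (2 * pi * s) * cis (2 * pi * of_int n)"
      by (simp add: cis_mult algebra_simps)
    also have "cis (2 * pi * of_int n) = 1" by (rule cis_multiple_2pi) auto
    finally show ?thesis by simp
  qed
  ultimately show ?thesis by (simp add: mode_def)
qed

lemma has_derivative_cis: "(cis has_derivative (\<lambda>h. h *\<^sub>R (\<i> * cis t))) (at t within A)"
proof -
  have "((\<lambda>t. exp (t *\<^sub>R \<i>)) has_vector_derivative exp (t *\<^sub>R \<i>) * \<i>) (at t within A)"
    by (rule exp_scaleR_has_vector_derivative_right)
  then have "((\<lambda>t. exp (\<i> * complex_of_real t)) has_derivative (\<lambda>h. h *\<^sub>R (\<i> * cis t))) (at t within A)"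
    by (simp add: has_vector_derivative_def scaleR_conv_of_real cis_conv_exp mult.commute)
  then show ?thesis by (simp add: cis_conv_exp[abs_def])
qed

lemma has_derivative_mode:
  "(mode k has_derivative (\<lambda>h. of_real (2 * pi * (\<Sum>i\<in>UNIV. of_int (k $ i) * h $ i)) * \<i> * mode k x)) (at x)"
proof -
  have "((\<lambda>x::real^3. 2 * pi * (\<Sum>i\<in>UNIV. of_int (k $ i) * x $ i)) has_derivative
      (\<lambda>h. 2 * pi * (\<Sum>i\<in>UNIV. of_int (k $ i) * h $ i))) (at x)"
    by (intro has_derivative_mult_right has_derivative_sum
        bounded_linear_imp_has_derivative[OF bounded_linear_vec_nth])
  moreover have "(cis has_derivative (\<lambda>h. h *\<^sub>R (\<i> * cis t))) (at t)" for t
    by (rule has_derivative_cis)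
  ultimately show ?thesis
    unfolding mode_def
    by (rule has_derivative_eq_rhs[OF has_derivative_compose[where g=cis]]) (auto simp: scaleR_conv_of_real)
qed

lemma continuous_on_mode [continuous_intros]: "continuous_on S (mode k)"
  using has_derivative_mode by (meson continuous_at_imp_continuous_on has_derivative_continuous)

text \<open>For nonzero \<open>n\<close> an antiderivative takes the same value at both ends of the
  unit interval.\<close>

lemma integral_cis:
  "(LINT y|lborel. indicator {0..1} y *\<^sub>R cis (2 * pi * of_int n * y)) = (if n = 0 then 1 else 0)"
proof (cases "n = 0")
  case True
  then show ?thesis by simp
next
  case False
  define a where "a = 2 * pi * of_int n"
  have a: "a \<noteq> 0" using False by (simp add: a_def)
  have "(LINT y|lborel. indicator {0..1} y *\<^sub>R cis (a * y)) = cis (a * 1) / (\<i> * a) - cis (a * 0) / (\<i> * a)"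
  proof (rule integral_FTC_Icc)
    show "((\<lambda>y. cis (a * y) / (\<i> * a)) has_vector_derivative cis (a * y)) (at y within {0..1})" for y
    proof -
      have "((\<lambda>y. cis (a * y)) has_vector_derivative a *\<^sub>R (\<i> * cis (a * y))) (at y within {0..1})"
        unfolding has_vector_derivative_def
        by (rule has_derivative_eq_rhs[OF has_derivative_compose[where g=cis, OF _ has_derivative_cis]])
           (auto intro!: derivative_eq_intros simp: algebra_simps)
      then have "((\<lambda>y. cis (a * y) / (\<i> * a)) has_vector_derivative (a *\<^sub>R (\<i> * cis (a * y))) / (\<i> * a)) (at y within {0..1})"
        by (rule has_vector_derivative_divide)
      then show ?thesis using a by (simp add: scaleR_conv_of_real)
    qed
    show "continuous_on {0..1} (\<lambda>y. cis (a * y))"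
      by (intro continuous_intros)
  qed simp
  moreover have "cis (a * 1) = 1" unfolding a_def mult_1_right by (rule cis_multiple_2pi) auto
  ultimately show ?thesis using False by (simp add: a_def)
qed

lemma cis_sum: "cis (\<Sum>i\<in>A. f i) = (\<Prod>i\<in>A. cis (f i))"
  by (induction A rule: infinite_finite_induct) (auto simp: cis_mult[symmetric])

lemma integral_mode: "(LINT x|torus. mode k x) = (if k = 0 then 1 else 0)"
proof -
  \<comment> \<open>Each factor carries the indicator of the unit interval, so the product over the
    coordinates is the mode restricted to the cube.\<close>
  define h where "h b y = indicator {0..1} y *\<^sub>R cis (2 * pi * of_int (k $ axis_index b) * y)" for b :: "real^3" and y
  have inj: "inj (\<lambda>i::3. axis i (1::real))" by (auto simp: inj_def axis_eq_axis)
  have B: "(Basis::(real^3) set) = range (\<lambda>i. axis i 1)" by (auto simp: Basis_vec_def)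
  have int: "integrable lborel (h b)" for b
    unfolding h_def
    by (rule borel_integrable_compact) (auto intro!: continuous_intros)
  have *: "indicator (cbox 0 1) x *\<^sub>R mode k x = (\<Prod>b\<in>Basis. h b (x \<bullet> b))" for x
  proof -
    have 1: "(\<Prod>b\<in>Basis. h b (x \<bullet> b)) = (\<Prod>i\<in>UNIV. h (axis i 1) (x $ i))"
      unfolding B by (subst prod.reindex[OF inj]) (simp add: inner_axis)
    have 2: "h (axis i 1) (x $ i) = of_real (indicator {0..1} (x $ i)) * cis (2 * pi * of_int (k $ i) * x $ i)" for i
      unfolding h_def axis_index_axis scaleR_conv_of_real by (rule refl)
    have 3: "indicator (cbox 0 1) x = (\<Prod>i\<in>UNIV. indicator {0..1} (x $ i) :: real)"
    proof (cases "x \<in> cbox 0 1")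
      case True
      then have "(\<Prod>i\<in>UNIV. indicator {0..1} (x $ i) :: real) = 1"
        by (intro prod.neutral) (simp add: mem_box_cart)
      then show ?thesis using True by simp
    next
      case False
      then obtain i where "x $ i \<notin> {0..1}" by (auto simp: mem_box_cart)
      then have "(\<Prod>i\<in>UNIV. indicator {0..1} (x $ i) :: real) = 0"
        by (intro prod_zero) (auto simp: indicator_def)
      then show ?thesis using False by simp
    qed
    have 4: "mode k x = (\<Prod>i\<in>UNIV. cis (2 * pi * of_int (k $ i) * x $ i))"
      by (simp add: mode_def cis_sum sum_distrib_left mult.assoc)
    show ?thesis
      by (simp only: 1 2 3 4 scaleR_conv_of_real of_real_prod prod.distrib)
  qed
  have "(LINT x|torus. mode k x) = (\<Prod>b\<in>Basis. LINT y|lborel. h b y)"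
    unfolding integral_torus[OF continuous_on_mode] * by (rule integral_lborel_prod[OF int])
  also have "\<dots> = (\<Prod>i\<in>UNIV. if k $ i = 0 then 1 else 0)"
    unfolding B by (subst prod.reindex[OF inj]) (simp add: h_def[abs_def] integral_cis)
  also have "\<dots> = (if k = 0 then 1 else 0)"
    by (auto simp: vec_eq_iff)
  finally show ?thesis .
qed

section \<open>Trigonometric sums: derivatives, products and Parseval's identity\<close>

definition trig_sum :: "(int^3) set \<Rightarrow> (int^3 \<Rightarrow> complex) \<Rightarrow> real^3 \<Rightarrow> complex" where
  "trig_sum F c x = (\<Sum>k\<in>F. c k * mode k x)"

lemma continuous_on_trig_sum [continuous_intros]: "continuous_on S (trig_sum F c)"
  unfolding trig_sum_def by (intro continuous_intros)

lemma has_derivative_trig_sum: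
  "(trig_sum F c has_derivative (\<lambda>h. trig_sum F (\<lambda>k. of_real (2 * pi * (\<Sum>i\<in>UNIV. of_int (k $ i) * h $ i)) * \<i> * c k) x)) (at x)"
proof -
  have "((\<lambda>x. \<Sum>k\<in>F. c k * mode k x) has_derivative
     (\<lambda>h. \<Sum>k\<in>F. c k * (of_real (2 * pi * (\<Sum>i\<in>UNIV. of_int (k $ i) * h $ i)) * \<i> * mode k x))) (at x)"
    by (intro has_derivative_sum has_derivative_mult_right has_derivative_mode)
  then show ?thesis unfolding trig_sum_def by (simp add: mult_ac)
qed

text \<open>The Fourier multiplier of differentiation in direction \<open>j\<close>, kept as a map
  on coefficient families so that the induction over \<open>C_k\<close> can iterate it.\<close>

definition dcoeff :: "3 \<Rightarrow> (int^3 \<Rightarrow> complex) \<Rightarrow> int^3 \<Rightarrow> complex" where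
  "dcoeff j c k = of_real (2 * pi * of_int (k $ j)) * \<i> * c k"

lemma Re_trig_sum_derivative:
  shows "(\<lambda>x. Re (trig_sum F c x)) differentiable (at x)"
    and "partial_deriv j (\<lambda>x. Re (trig_sum F c x)) x = Re (trig_sum F (dcoeff j c) x)"
proof -
  have d: "((\<lambda>x. Re (trig_sum F c x)) has_derivative
     (\<lambda>h. Re (trig_sum F (\<lambda>k. of_real (2 * pi * (\<Sum>i\<in>UNIV. of_int (k $ i) * h $ i)) * \<i> * c k) x))) (at x)"
    by (rule bounded_linear.has_derivative[OF bounded_linear_Re has_derivative_trig_sum])
  then show "(\<lambda>x. Re (trig_sum F c x)) differentiable (at x)"
    by (auto simp: differentiable_def)
  have "(\<Sum>i\<in>UNIV. real_of_int (k $ i) * axis j 1 $ i) = of_int (k $ j)" for k :: "int^3"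
    by (simp add: axis_def if_distrib cong: if_cong)
  then show "partial_deriv j (\<lambda>x. Re (trig_sum F c x)) x = Re (trig_sum F (dcoeff j c) x)"
    unfolding partial_deriv_def frechet_derivative_at[OF d, symmetric] dcoeff_def by simp
qed

lemma C_k_Re_trig_sum: "C_k n (\<lambda>x. Re (trig_sum F c x))"
proof (induction n arbitrary: c)
  case 0
  then show ?case by (auto intro!: continuous_intros)
next
  case (Suc n)
  have "partial_deriv j (\<lambda>x. Re (trig_sum F c x)) = (\<lambda>x. Re (trig_sum F (dcoeff j c) x))" for j
    by (simp add: fun_eq_iff Re_trig_sum_derivative)
  then show ?case using Suc Re_trig_sum_derivative(1) by simp
qed

lemma Re_trig_sum_test_function: "(\<lambda>x. Re (trig_sum F c x)) \<in> test_functions"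
  unfolding test_functions_def
  by (auto simp: C_k_Re_trig_sum) (simp add: periodic_def trig_sum_def mode_shift)

text \<open>Pairs are grouped by their sum \<open>m\<close>. The summand is left general because the
  identity serves twice: for the coefficients of a product, and to resum the weights in
  \<open>trig_sum_L4_bound\<close>.\<close>

lemma sum_convolution:
  fixes f :: "'a::ab_group_add \<Rightarrow> 'a \<Rightarrow> 'b::comm_monoid_add"
  assumes "finite F" "finite G"
  shows "(\<Sum>k\<in>F. \<Sum>l\<in>G. f k l) =
    (\<Sum>m\<in>(\<lambda>(k, l). k + l) ` (F \<times> G). \<Sum>k\<in>{k\<in>F. m - k \<in> G}. f k (m - k))"
proof -
  have "(\<Sum>k\<in>F. \<Sum>l\<in>G. f k l) = (\<Sum>(k, l)\<in>F \<times> G. f k l)"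
    by (rule sum.cartesian_product)
  also have "\<dots> = (\<Sum>m\<in>(\<lambda>(k, l). k + l) ` (F \<times> G). \<Sum>p\<in>{p\<in>F \<times> G. (case p of (k, l) \<Rightarrow> k + l) = m}. case p of (k, l) \<Rightarrow> f k l)"
    using assms by (intro sum.image_gen) auto
  also have "\<dots> = (\<Sum>m\<in>(\<lambda>(k, l). k + l) ` (F \<times> G). \<Sum>k\<in>{k\<in>F. m - k \<in> G}. f k (m - k))"
    by (intro sum.cong refl sum.reindex_bij_witness[where i="\<lambda>k. (k, _ - k)" and j=fst]) auto
  finally show ?thesis .
qed

lemma trig_sum_mult:
  assumes "finite F" "finite G"
  shows "trig_sum F c x * trig_sum G d x =
    trig_sum ((\<lambda>(k, l). k + l) ` (F \<times> G)) (\<lambda>m. \<Sum>k\<in>{k\<in>F. m - k \<in> G}. c k * d (m - k)) x"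
proof -
  have "trig_sum F c x * trig_sum G d x = (\<Sum>k\<in>F. \<Sum>l\<in>G. c k * d l * mode (k + l) x)"
    by (simp add: trig_sum_def sum_product mode_add mult_ac)
  also have "\<dots> = (\<Sum>m\<in>(\<lambda>(k, l). k + l) ` (F \<times> G). \<Sum>k\<in>{k\<in>F. m - k \<in> G}. c k * d (m - k) * mode m x)"
    unfolding sum_convolution[OF assms] by simp
  finally show ?thesis by (simp add: trig_sum_def sum_distrib_right)
qed

text \<open>Only the diagonal of the double sum survives, by \<open>integral_mode\<close> at the
  difference of two frequencies.\<close>

lemma Parseval_trig_sum:
  assumes "finite F"
  shows "(LINT x|torus. (cmod (trig_sum F c x))\<^sup>2) = (\<Sum>k\<in>F. (cmod (c k))\<^sup>2)"
proof -
  have int: "integrable torus (\<lambda>x. c k * cnj (c l) * mode (k - l) x)" for k l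
    by (intro continuous_integrable_torus continuous_intros)
  have "complex_of_real (LINT x|torus. (cmod (trig_sum F c x))\<^sup>2) = (LINT x|torus. of_real ((cmod (trig_sum F c x))\<^sup>2))"
    by (rule integral_complex_of_real[symmetric])
  also have "\<dots> = (LINT x|torus. (\<Sum>k\<in>F. \<Sum>l\<in>F. c k * cnj (c l) * mode (k - l) x))"
  proof (intro Bochner_Integration.integral_cong refl)
    fix x
    have "mode (k - l) x = mode k x * cnj (mode l x)" for k l
      by (simp only: diff_conv_add_uminus mode_add cnj_mode)
    then show "complex_of_real ((cmod (trig_sum F c x))\<^sup>2) = (\<Sum>k\<in>F. \<Sum>l\<in>F. c k * cnj (c l) * mode (k - l) x)"
      unfolding complex_norm_square trig_sum_def by (simp add: sum_product mult_ac)
  qed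
  also have "\<dots> = (\<Sum>k\<in>F. \<Sum>l\<in>F. c k * cnj (c l) * (LINT x|torus. mode (k - l) x))"
    using int by (simp add: Bochner_Integration.integral_sum Bochner_Integration.integrable_sum)
  also have "\<dots> = (\<Sum>k\<in>F. c k * cnj (c k))"
    using assms by (simp add: integral_mode if_distrib cong: if_cong)
  also have "\<dots> = of_real (\<Sum>k\<in>F. (cmod (c k))\<^sup>2)"
    by (simp only: of_real_sum complex_norm_square)
  finally show ?thesis by (simp only: of_real_eq_iff)
qed

subsection \<open>The fourth-power bound and Fourier coefficients\<close>

text \<open>The weight of the first-order Sobolev norm on the Fourier side (the square of the
  Japanese bracket), without the constant that differentiating a mode produces.\<close>

definition bracket :: "int^3 \<Rightarrow> real" where
  "bracket k = 1 + (\<Sum>i\<in>UNIV. (of_int (k $ i))\<^sup>2)"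

lemma bracket_ge: "1 + (of_int (k $ i))\<^sup>2 \<le> bracket k"
  unfolding bracket_def by (intro add_left_mono member_le_sum) auto

lemma bracket_pos [simp]: "bracket k > 0"
  using bracket_ge[of k undefined] by (smt (verit) zero_le_power2)

text \<open>The exponent is the share of one coordinate when the inverse square of
  \<open>bracket\<close> is distributed evenly over three. The terms then decay like
  \<open>real n powr (-4/3)\<close>, which is summable.\<close>

lemma sum_int_decay_bounded:
  obtains B where "\<And>A. finite A \<Longrightarrow> (\<Sum>j\<in>A. (1 + (real_of_int j)\<^sup>2) powr (-2/3)) \<le> B"
proof -
  define u where "u j = (1 + (real_of_int j)\<^sup>2) powr (-2/3)" for j
  have sm: "summable (\<lambda>n. u (int n))"
  proof (rule summable_comparison_test_ev)
    show "summable (\<lambda>n. real n powr (-4/3))" by (simp add: summable_real_powr_iff)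
    have "norm (u (int n)) \<le> real n powr (-4/3)" if "n > 0" for n
    proof -
      have "u (int n) \<le> ((real n)\<^sup>2) powr (-2/3)"
        unfolding u_def using that by (intro powr_mono2') auto
      also have "\<dots> = (real n powr 2) powr (-2/3)" using that by (simp add: powr_numeral)
      also have "\<dots> = real n powr (-4/3)" by (simp only: powr_powr) simp
      finally show ?thesis by (simp add: u_def)
    qed
    then show "\<forall>\<^sub>F n in sequentially. norm (u (int n)) \<le> real n powr (-4/3)"
      by (intro eventually_mono[OF eventually_gt_at_top[of 0]]) auto
  qed
  have half: "(\<Sum>j\<in>A. u j) \<le> suminf (\<lambda>n. u (int n))" if "finite A" "\<And>j. j \<in> A \<Longrightarrow> j \<ge> 0" for A
  proof -
    have "(\<Sum>j\<in>A. u j) = (\<Sum>n\<in>nat ` A. u (int n))"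
      using that by (subst sum.reindex) (auto intro!: inj_onI sum.cong simp: eq_nat_nat_iff)
    also have "\<dots> \<le> suminf (\<lambda>n. u (int n))"
      using that by (intro sum_le_suminf sm) (auto simp: u_def)
    finally show ?thesis .
  qed
  have "(\<Sum>j\<in>A. u j) \<le> 2 * suminf (\<lambda>n. u (int n))" if "finite A" for A
  proof -
    have "(\<Sum>j\<in>A. u j) = (\<Sum>j\<in>{j\<in>A. j \<ge> 0}. u j) + (\<Sum>j\<in>{j\<in>A. \<not> j \<ge> 0}. u j)"
      using that by (subst sum.union_disjoint[symmetric]) (auto intro!: sum.cong)
    moreover have "(\<Sum>j\<in>{j\<in>A. \<not> j \<ge> 0}. u j) = (\<Sum>j\<in>uminus ` {j\<in>A. \<not> j \<ge> 0}. u j)"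
      by (subst sum.reindex) (auto simp: u_def)
    moreover have "(\<Sum>j\<in>{j\<in>A. j \<ge> 0}. u j) \<le> suminf (\<lambda>n. u (int n))"
      "(\<Sum>j\<in>uminus ` {j\<in>A. \<not> j \<ge> 0}. u j) \<le> suminf (\<lambda>n. u (int n))"
      using that by (intro half; auto)+
    ultimately show ?thesis by linarith
  qed
  then show ?thesis using that unfolding u_def by blast
qed

text \<open>No lattice points are counted in balls: as \<open>bracket\<close> dominates one plus the
  square of each coordinate, its inverse square is at most a product of three one-dimensional terms,
  and their sum over a cube of frequencies factorises.\<close>

lemma sum_bracket_decay_bounded:
  obtains B where "B \<ge> 0" "\<And>F. finite F \<Longrightarrow> (\<Sum>k\<in>F. 1 / (bracket k)\<^sup>2) \<le> B"
proof -
  define u where "u j = (1 + (real_of_int j)\<^sup>2) powr (-2/3)" for j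
  obtain B where B: "\<And>A. finite A \<Longrightarrow> (\<Sum>j\<in>A. u j) \<le> B"
    using sum_int_decay_bounded unfolding u_def by blast
  have B0: "B \<ge> 0" using B[of "{}"] by simp
  have le: "1 / (bracket k)\<^sup>2 \<le> (\<Prod>i\<in>UNIV. u (k $ i))" for k
  proof -
    have "1 / (bracket k)\<^sup>2 = bracket k powr (- 2)"
      using bracket_pos[of k] by (simp add: powr_minus powr_numeral[OF less_imp_le] divide_inverse)
    also have "\<dots> = (bracket k powr (-2/3)) ^ 3"
      by (subst powr_power[OF less_imp_neq[OF bracket_pos, symmetric]]) simp
    also have "\<dots> = (\<Prod>i\<in>(UNIV::3 set). bracket k powr (-2/3))" by simp
    also have "\<dots> \<le> (\<Prod>i\<in>UNIV. u (k $ i))"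
      unfolding u_def using bracket_ge
      by (intro prod_mono conjI powr_mono2') (auto simp: add_pos_nonneg)
    finally show ?thesis .
  qed
  have "(\<Sum>k\<in>F. 1 / (bracket k)\<^sup>2) \<le> B ^ 3" if "finite F" for F
  proof -
    define A where "A = (\<lambda>(k, i). k $ i) ` (F \<times> UNIV)"
    have A: "finite A" using that by (simp add: A_def)
    have "(\<Sum>k\<in>F. 1 / (bracket k)\<^sup>2) \<le> (\<Sum>k\<in>F. \<Prod>i\<in>UNIV. u (k $ i))"
      by (intro sum_mono le)
    also have "\<dots> = (\<Sum>g\<in>vec_nth ` F. \<Prod>i\<in>UNIV. u (g i))"
      by (subst sum.reindex) (auto simp: inj_on_def vec_nth_inject)
    also have "\<dots> \<le> (\<Sum>g\<in>PiE UNIV (\<lambda>_::3. A). \<Prod>i\<in>UNIV. u (g i))"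
      using A by (intro sum_mono2 finite_PiE) (auto simp: A_def u_def intro!: prod_nonneg)
    also have "\<dots> = (\<Prod>i\<in>(UNIV::3 set). \<Sum>j\<in>A. u j)"
      using A by (intro prod_sum_PiE[symmetric]) auto
    also have "\<dots> \<le> B ^ 3"
      using B[OF A] by (simp add: u_def power_mono sum_nonneg)
    finally show ?thesis .
  qed
  then show ?thesis using that[of "B ^ 3"] B0 by simp
qed

text \<open>By Cauchy--Schwarz the \<open>m\<close>-th coefficient of the square is controlled by
  \<open>\<Sum>\<^sub>k 1 / (bracket k * bracket (m - k))\<close>, which AM-GM bounds uniformly in \<open>m\<close> by the series
  \<open>\<Sum>\<^sub>k 1 / (bracket k)\<^sup>2\<close>; this series converges because the dimension is less than four.\<close>

lemma trig_sum_L4_bound: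
  obtains C where "C \<ge> 0" "\<And>F c. finite F \<Longrightarrow>
    (LINT x|torus. (cmod (trig_sum F c x)) ^ 4) \<le> C * (\<Sum>k\<in>F. bracket k * (cmod (c k))\<^sup>2)\<^sup>2"
proof -
  obtain B where B: "B \<ge> 0" "\<And>F. finite F \<Longrightarrow> (\<Sum>k\<in>F. 1 / (bracket k)\<^sup>2) \<le> B"
    using sum_bracket_decay_bounded by blast
  have "(LINT x|torus. (cmod (trig_sum F c x)) ^ 4) \<le> B * (\<Sum>k\<in>F. bracket k * (cmod (c k))\<^sup>2)\<^sup>2"
    if F: "finite F" for F c
  proof -
    define G where "G = (\<lambda>(k, l). k + l) ` (F \<times> F)"
    define K where "K m = {k\<in>F. m - k \<in> F}" for m
    define w where "w k = bracket k * (cmod (c k))\<^sup>2" for k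
    have w0: "w k \<ge> 0" for k by (simp add: w_def less_imp_le)
    have fin: "finite G" "finite (K m)" for m using F by (auto simp: G_def K_def)
    have A: "(\<Sum>k\<in>K m. 1 / (bracket k * bracket (m - k))) \<le> B" for m
    proof -
      have "(\<Sum>k\<in>K m. 1 / (bracket k * bracket (m - k)))
          \<le> (\<Sum>k\<in>K m. (1 / (bracket k)\<^sup>2 + 1 / (bracket (m - k))\<^sup>2) / 2)"
      proof (rule sum_mono)
        fix k
        show "1 / (bracket k * bracket (m - k)) \<le> (1 / (bracket k)\<^sup>2 + 1 / (bracket (m - k))\<^sup>2) / 2"
          using sum_squares_bound[of "1 / bracket k" "1 / bracket (m - k)"]
          by (simp add: power_divide)
      qed
      also have "\<dots> = ((\<Sum>k\<in>K m. 1 / (bracket k)\<^sup>2) + (\<Sum>k\<in>K m. 1 / (bracket (m - k))\<^sup>2)) / 2"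
        by (simp only: sum_divide_distrib[symmetric] sum.distrib)
      \<comment> \<open>The reflection of \<open>k\<close> to \<open>m - k\<close> maps
        \<open>K m\<close> onto itself.\<close>
      also have "(\<Sum>k\<in>K m. 1 / (bracket (m - k))\<^sup>2) = (\<Sum>k\<in>K m. 1 / (bracket k)\<^sup>2)"
        by (rule sum.reindex_bij_witness[where i="\<lambda>k. m - k" and j="\<lambda>k. m - k"]) (auto simp: K_def)
      finally show ?thesis using B(2)[OF fin(2)[of m]] by simp
    qed
    have d: "(cmod (\<Sum>k\<in>K m. c k * c (m - k)))\<^sup>2 \<le> B * (\<Sum>k\<in>K m. w k * w (m - k))" for m
    proof -
      \<comment> \<open>The weights are split off before Cauchy-Schwarz: \<open>a\<close> collects
        the weighted coefficients, whose convolution can be resummed over \<open>m\<close>, and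
        \<open>b\<close> the inverse weights, whose sum is bounded by the fact
        \<open>A\<close>.\<close>
      define a where "a k = sqrt (w k * w (m - k))" for k
      define b where "b k = sqrt (1 / (bracket k * bracket (m - k)))" for k
      have ab: "a k * b k = cmod (c k * c (m - k))" for k
      proof -
        have "a k * b k = sqrt ((w k * w (m - k)) * (1 / (bracket k * bracket (m - k))))"
          by (simp only: a_def b_def real_sqrt_mult)
        also have "(w k * w (m - k)) * (1 / (bracket k * bracket (m - k))) = (cmod (c k * c (m - k)))\<^sup>2"
          using bracket_pos[of k] bracket_pos[of "m - k"]
          by (simp add: w_def norm_mult power_mult_distrib del: bracket_pos)
        finally show ?thesis by simp
      qed
      have "(cmod (\<Sum>k\<in>K m. c k * c (m - k)))\<^sup>2 \<le> (\<Sum>k\<in>K m. a k * b k)\<^sup>2"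
        unfolding ab by (intro power_mono norm_sum) auto
      also have "\<dots> \<le> (\<Sum>k\<in>K m. (a k)\<^sup>2) * (\<Sum>k\<in>K m. (b k)\<^sup>2)"
        by (rule Cauchy_Schwarz_ineq_sum)
      also have "\<dots> = (\<Sum>k\<in>K m. w k * w (m - k)) * (\<Sum>k\<in>K m. 1 / (bracket k * bracket (m - k)))"
        using w0 by (simp add: a_def b_def less_imp_le)
      also have "\<dots> \<le> (\<Sum>k\<in>K m. w k * w (m - k)) * B"
        using w0 by (intro mult_left_mono A sum_nonneg) auto
      finally show ?thesis by (simp add: mult.commute)
    qed
    \<comment> \<open>A fourth power is the squared modulus of a square, so Parseval's identity
      applies to the product sum.\<close>
    have "(cmod (trig_sum F c x)) ^ 4 = (cmod (trig_sum G (\<lambda>m. \<Sum>k\<in>K m. c k * c (m - k)) x))\<^sup>2" for x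
    proof -
      have "(cmod (trig_sum F c x)) ^ 4 = (cmod (trig_sum F c x * trig_sum F c x))\<^sup>2"
        by (simp add: norm_mult eval_nat_numeral)
      then show ?thesis unfolding trig_sum_mult[OF F F] G_def K_def .
    qed
    then have "(LINT x|torus. (cmod (trig_sum F c x)) ^ 4) = (\<Sum>m\<in>G. (cmod (\<Sum>k\<in>K m. c k * c (m - k)))\<^sup>2)"
      by (simp add: Parseval_trig_sum[OF fin(1)])
    also have "\<dots> \<le> (\<Sum>m\<in>G. B * (\<Sum>k\<in>K m. w k * w (m - k)))"
      by (intro sum_mono d)
    \<comment> \<open>Read backwards, the grouping by \<open>m\<close> restores the full double sum
      of weights, which is a perfect square.\<close>
    also have "\<dots> = B * (\<Sum>k\<in>F. \<Sum>l\<in>F. w k * w l)"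
      unfolding sum_convolution[OF F F] G_def K_def by (rule sum_distrib_left[symmetric])
    also have "\<dots> = B * (\<Sum>k\<in>F. w k)\<^sup>2"
      by (simp add: power2_eq_square sum_product)
    finally show ?thesis by (simp add: w_def)
  qed
  with B(1) show ?thesis by (rule that)
qed

section \<open>Fourier coefficients, Bessel's inequality and best approximation\<close>

definition fourier :: "(real^3 \<Rightarrow> real) \<Rightarrow> int^3 \<Rightarrow> complex" where
  "fourier f k = (LINT x|torus. complex_of_real (f x) * cnj (mode k x))"

lemma square_integrable_mult_continuous_integrable:
  fixes f :: "real^3 \<Rightarrow> real" and p :: "real^3 \<Rightarrow> complex"
  assumes f: "square_integrable torus f" and p: "continuous_on UNIV p"
  shows "integrable torus (\<lambda>x. complex_of_real (f x) * p x)"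
proof (rule square_integrable_integrable[OF f continuous_square_integrable_torus[OF p]])
  have [measurable]: "f \<in> borel_measurable torus" "p \<in> borel_measurable torus"
    using f p by (auto simp: square_integrable_def intro: borel_measurable_torusI)
  show "(\<lambda>x. complex_of_real (f x) * p x) \<in> borel_measurable torus" by measurable
qed (simp add: norm_mult)

text \<open>Completing the square in the coefficients. The middle sum vanishes when \<open>c\<close>
  is the family of Fourier coefficients; Bessel's inequality and the best approximation property
  both follow from this identity.\<close>

lemma trig_sum_distance:
  assumes f: "square_integrable torus f" and F: "finite F"
  shows "(LINT x|torus. (cmod (complex_of_real (f x) - trig_sum F c x))\<^sup>2) =
    (LINT x|torus. (f x)\<^sup>2) + (\<Sum>k\<in>F. (cmod (c k - fourier f k))\<^sup>2) - (\<Sum>k\<in>F. (cmod (fourier f k))\<^sup>2)"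
proof -
  have int: "integrable torus (\<lambda>x. complex_of_real (f x) * mode k x)" for k
    by (intro square_integrable_mult_continuous_integrable f continuous_intros)
  have f2: "integrable torus (\<lambda>x. (f x)\<^sup>2)" using f by (simp add: square_integrable_def)
  have p2: "integrable torus (\<lambda>x. (cmod (trig_sum F c x))\<^sup>2)"
    by (intro continuous_integrable_torus continuous_intros)
  have fp: "integrable torus (\<lambda>x. complex_of_real (f x) * trig_sum F c x)"
    by (intro square_integrable_mult_continuous_integrable f continuous_intros)
  have mode: "(LINT x|torus. complex_of_real (f x) * mode k x) = cnj (fourier f k)" for k
    unfolding fourier_def Bochner_Integration.integral_cnj[symmetric] by simp
  have "(LINT x|torus. complex_of_real (f x) * trig_sum F c x) =
      (LINT x|torus. (\<Sum>k\<in>F. c k * (complex_of_real (f x) * mode k x)))"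
    by (simp add: trig_sum_def sum_distrib_left mult_ac)
  also have "\<dots> = (\<Sum>k\<in>F. c k * cnj (fourier f k))"
    using int by (simp add: Bochner_Integration.integral_sum mode)
  finally have I: "(LINT x|torus. complex_of_real (f x) * trig_sum F c x) = (\<Sum>k\<in>F. c k * cnj (fourier f k))" .
  have sq: "(cmod (a - b))\<^sup>2 = (cmod a)\<^sup>2 - 2 * Re (b * cnj a) + (cmod b)\<^sup>2" for a b
    by (simp only: cmod_power2) (simp add: power2_eq_square algebra_simps)
  have "(LINT x|torus. (cmod (complex_of_real (f x) - trig_sum F c x))\<^sup>2) =
     (LINT x|torus. (f x)\<^sup>2 - 2 * Re (complex_of_real (f x) * trig_sum F c x) + (cmod (trig_sum F c x))\<^sup>2)"
    unfolding sq by (simp add: mult.commute)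
  also have "\<dots> = (LINT x|torus. (f x)\<^sup>2) - 2 * Re (\<Sum>k\<in>F. c k * cnj (fourier f k)) + (\<Sum>k\<in>F. (cmod (c k))\<^sup>2)"
  proof -
    have "integrable torus (\<lambda>x. 2 * Re (complex_of_real (f x) * trig_sum F c x))"
      using fp by (intro Bochner_Integration.integrable_mult_right integrable_Re) auto
    then show ?thesis
      unfolding I[symmetric] Parseval_trig_sum[OF F, symmetric]
      using f2 p2 fp by (simp del: times_complex.sel mult_cancel_left Re_complex_of_real)
  qed
  also have "\<dots> = (LINT x|torus. (f x)\<^sup>2) + (\<Sum>k\<in>F. (cmod (c k - fourier f k))\<^sup>2) - (\<Sum>k\<in>F. (cmod (fourier f k))\<^sup>2)"
  proof -
    have "(cmod (c k - fourier f k))\<^sup>2 = (cmod (c k))\<^sup>2 - 2 * Re (c k * cnj (fourier f k)) + (cmod (fourier f k))\<^sup>2" for k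
      unfolding sq by (simp add: mult.commute)
    then show ?thesis by (simp add: sum.distrib sum_subtractf sum_distrib_left)
  qed
  finally show ?thesis .
qed

lemma Bessel:
  assumes "square_integrable torus f" "finite F"
  shows "(\<Sum>k\<in>F. (cmod (fourier f k))\<^sup>2) \<le> (LINT x|torus. (f x)\<^sup>2)"
proof -
  have "0 \<le> (LINT x|torus. (cmod (complex_of_real (f x) - trig_sum F (fourier f) x))\<^sup>2)" by simp
  then show ?thesis unfolding trig_sum_distance[OF assms] by simp
qed

text \<open>\<open>G\<close> may be larger than \<open>F\<close>, so a single good trigonometric
  polynomial controls all later Fourier partial sums. This turns density into convergence of the
  whole sequence.\<close>

lemma fourier_best_approximation:
  assumes f: "square_integrable torus f" and "finite G" "F \<subseteq> G"
  shows "(LINT x|torus. (cmod (complex_of_real (f x) - trig_sum G (fourier f) x))\<^sup>2)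
       \<le> (LINT x|torus. (cmod (complex_of_real (f x) - trig_sum F c x))\<^sup>2)"
proof -
  have F: "finite F" using assms finite_subset by blast
  have "(\<Sum>k\<in>F. (cmod (fourier f k))\<^sup>2) \<le> (\<Sum>k\<in>G. (cmod (fourier f k))\<^sup>2)"
    using assms by (intro sum_mono2) auto
  moreover have "0 \<le> (\<Sum>k\<in>F. (cmod (c k - fourier f k))\<^sup>2)" by (intro sum_nonneg) auto
  ultimately show ?thesis
    unfolding trig_sum_distance[OF f F] trig_sum_distance[OF f \<open>finite G\<close>] by simp
qed

definition freqs :: "nat \<Rightarrow> (int^3) set" where
  "freqs n = {k. \<forall>i. \<bar>k $ i\<bar> \<le> int n}"

lemma finite_freqs [simp]: "finite (freqs n)"
proof -
  have "vec_nth ` freqs n \<subseteq> PiE UNIV (\<lambda>_. {- int n..int n})"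
    by (auto simp: freqs_def abs_le_iff) (metis minus_le_iff)
  then have "finite (vec_nth ` freqs n)"
    by (rule finite_subset) (intro finite_PiE, auto)
  then show ?thesis by (rule finite_imageD) (auto simp: inj_on_def vec_nth_inject)
qed

lemma freqs_mono: "m \<le> n \<Longrightarrow> freqs m \<subseteq> freqs n"
  by (auto simp: freqs_def) (meson of_nat_le_iff order_trans)

lemma finite_subset_freqs:
  assumes "finite F"
  obtains n where "F \<subseteq> freqs n"
proof -
  define A where "A = (\<lambda>(k, i). nat \<bar>k $ i\<bar>) ` (F \<times> UNIV)"
  have A: "finite A" using assms by (simp add: A_def)
  have "F \<subseteq> freqs (Max A)"
  proof (clarsimp simp: freqs_def)
    fix k i assume "k \<in> F"
    then have "nat \<bar>k $ i\<bar> \<in> A" by (force simp: A_def)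
    then have "nat \<bar>k $ i\<bar> \<le> Max A" using A by simp
    then show "\<bar>k $ i\<bar> \<le> int (Max A)" by simp
  qed
  then show ?thesis by (rule that)
qed

subsection \<open>Density of trigonometric polynomials\<close>

definition trig_poly :: "(real^3 \<Rightarrow> complex) \<Rightarrow> bool" where
  "trig_poly p \<longleftrightarrow> (\<exists>F c. finite F \<and> p = trig_sum F c)"

lemma trig_poly_mode: "trig_poly (\<lambda>x. a * mode k x)"
  unfolding trig_poly_def
  by (intro exI[of _ "{k}"] exI[of _ "\<lambda>_. a"]) (auto simp: trig_sum_def)

lemma trig_poly_const: "trig_poly (\<lambda>x. a)"
  using trig_poly_mode[of a 0] by simp

lemma trig_poly_add:
  assumes "trig_poly p" "trig_poly q"
  shows "trig_poly (\<lambda>x. p x + q x)"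
proof -
  obtain F c G d where F: "finite F" "p = trig_sum F c" and G: "finite G" "q = trig_sum G d"
    using assms by (auto simp: trig_poly_def)
  have *: "trig_sum A a x = trig_sum (F \<union> G) (\<lambda>k. if k \<in> A then a k else 0) x" if "A \<subseteq> F \<union> G" for A a x
    unfolding trig_sum_def using F(1) G(1) that by (intro sum.mono_neutral_cong_left) auto
  have "(\<lambda>x. p x + q x) = trig_sum (F \<union> G) (\<lambda>k. (if k \<in> F then c k else 0) + (if k \<in> G then d k else 0))"
    unfolding F(2) G(2) by (subst (1 2) *) (auto simp: trig_sum_def distrib_right sum.distrib)
  then show ?thesis using F(1) G(1) unfolding trig_poly_def by blast
qed

lemma trig_poly_mult:
  assumes "trig_poly p" "trig_poly q"
  shows "trig_poly (\<lambda>x. p x * q x)"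
proof -
  obtain F c G d where F: "finite F" "p = trig_sum F c" and G: "finite G" "q = trig_sum G d"
    using assms by (auto simp: trig_poly_def)
  have "finite ((\<lambda>(k, l). k + l) ` (F \<times> G))" using F(1) G(1) by simp
  then show ?thesis
    unfolding trig_poly_def F(2) G(2) trig_sum_mult[OF F(1) G(1)] by blast
qed

lemma trig_poly_sum: "(\<And>i. i \<in> I \<Longrightarrow> trig_poly (p i)) \<Longrightarrow> trig_poly (\<lambda>x. \<Sum>i\<in>I. p i x)"
  by (induction I rule: infinite_finite_induct) (auto intro: trig_poly_const trig_poly_add)

lemma trig_poly_continuous: "trig_poly p \<Longrightarrow> continuous_on S p"
  by (auto simp: trig_poly_def intro: continuous_on_trig_sum)

section \<open>The torus as a compact subset of six-dimensional space\<close>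

definition torus_embedding :: "real^3 \<Rightarrow> (real^3) \<times> (real^3)" where
  "torus_embedding x = ((\<chi> i. cos (2 * pi * x $ i)), (\<chi> i. sin (2 * pi * x $ i)))"

lemma continuous_on_torus_embedding: "continuous_on S torus_embedding"
  unfolding torus_embedding_def by (intro continuous_intros)

lemma trig_poly_cos_sin:
  "trig_poly (\<lambda>x. of_real (cos (2 * pi * x $ i)))" "trig_poly (\<lambda>x. of_real (sin (2 * pi * x $ i)))"
proof -
  have m: "mode (axis i 1) x = cis (2 * pi * x $ i)" "mode (axis i (- 1)) x = cis (- (2 * pi * x $ i))" for x
    by (simp_all add: mode_def axis_def if_distrib if_distribR cong: if_cong)
  have "(\<lambda>x. complex_of_real (cos (2 * pi * x $ i))) = (\<lambda>x. (1/2) * mode (axis i 1) x + (1/2) * mode (axis i (- 1)) x)"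
    unfolding m by (auto simp: complex_eq_iff)
  then show "trig_poly (\<lambda>x. of_real (cos (2 * pi * x $ i)))"
    by (simp only:) (intro trig_poly_add trig_poly_mode)
  have "(\<lambda>x. complex_of_real (sin (2 * pi * x $ i))) = (\<lambda>x. (- \<i>/2) * mode (axis i 1) x + (\<i>/2) * mode (axis i (- 1)) x)"
    unfolding m by (auto simp: complex_eq_iff)
  then show "trig_poly (\<lambda>x. of_real (sin (2 * pi * x $ i)))"
    by (simp only:) (intro trig_poly_add trig_poly_mode)
qed

text \<open>The coordinates of the embedding are cosines and sines, so polynomials pull back to
  trigonometric polynomials; this links Stone--Weierstrass to the density of the modes.\<close>

lemma trig_poly_real_polynomial_function:
  assumes "real_polynomial_function g"
  shows "trig_poly (\<lambda>x. complex_of_real (g (torus_embedding x)))"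
  using assms
proof induction
  case (linear f)
  interpret bounded_linear f by fact
  have e: "(\<chi> i. v i) = (\<Sum>i\<in>UNIV. v i *\<^sub>R axis i 1)" for v :: "3 \<Rightarrow> real"
    by (simp add: vec_eq_iff axis_def if_distrib cong: if_cong)
  have "torus_embedding x = (\<Sum>i\<in>UNIV. cos (2 * pi * x $ i) *\<^sub>R (axis i 1, 0) + sin (2 * pi * x $ i) *\<^sub>R (0, axis i 1))" for x
    unfolding torus_embedding_def e by (simp add: prod_eq_iff fst_sum snd_sum)
  then have "f (torus_embedding x) = (\<Sum>i\<in>UNIV. f (cos (2 * pi * x $ i) *\<^sub>R (axis i 1, 0) + sin (2 * pi * x $ i) *\<^sub>R (0, axis i 1)))" for x
    by (simp only: sum)
  then have "f (torus_embedding x) = (\<Sum>i\<in>UNIV. f (axis i 1, 0) * cos (2 * pi * x $ i) + f (0, axis i 1) * sin (2 * pi * x $ i))" for x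
    by (simp only: add scaleR real_scaleR_def mult.commute)
  then have "(\<lambda>x. complex_of_real (f (torus_embedding x))) =
     (\<lambda>x. \<Sum>i\<in>UNIV. of_real (f (axis i 1, 0)) * of_real (cos (2 * pi * x $ i)) + of_real (f (0, axis i 1)) * of_real (sin (2 * pi * x $ i)))"
    by simp
  then show ?case
    by (simp only:) (intro trig_poly_sum trig_poly_add trig_poly_mult trig_poly_const trig_poly_cos_sin)
next
  case (const c)
  then show ?case by (rule trig_poly_const)
next
  case (add f g)
  then show ?case using trig_poly_add by simp
next
  case (mult f g)
  then show ?case using trig_poly_mult by simp
qed

text \<open>A continuous map from a compact space to a Hausdorff space is closed, hence a quotient
  map onto its image, and functions constant on its fibres descend continuously.\<close>

lemma continuous_factor:
  fixes T :: "'a::t2_space \<Rightarrow> 'b::t2_space" and h :: "'a \<Rightarrow> 'c::topological_space"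
  assumes K: "compact K" and T: "continuous_on K T" and h: "continuous_on K h"
    and eq: "\<And>x y. x \<in> K \<Longrightarrow> y \<in> K \<Longrightarrow> T x = T y \<Longrightarrow> h x = h y"
  obtains H where "continuous_on (T ` K) H" "\<And>x. x \<in> K \<Longrightarrow> H (T x) = h x"
proof -
  define H where "H s = h (SOME x. x \<in> K \<and> T x = s)" for s
  have H: "H (T x) = h x" if "x \<in> K" for x
  proof -
    have "(SOME y. y \<in> K \<and> T y = T x) \<in> K \<and> T (SOME y. y \<in> K \<and> T y = T x) = T x"
      by (rule someI[of _ x]) (use that in simp)
    then show ?thesis unfolding H_def using eq that by blast
  qed
  have cl: "closed (T ` K)" by (intro compact_imp_closed compact_continuous_image K T)
  have "continuous_on (T ` K) H"
    unfolding continuous_on_closed_vimage[OF cl]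
  proof (intro allI impI)
    fix B :: "'c set" assume "closed B"
    then have "closed (h -` B \<inter> K)"
      using h continuous_on_closed_vimage[OF compact_imp_closed[OF K]] by blast
    then have "compact (h -` B \<inter> K)"
      using K by (metis compact_Int_closed inf.right_idem inf_commute)
    then have "closed (T ` (h -` B \<inter> K))"
      by (intro compact_imp_closed compact_continuous_image continuous_on_subset[OF T]) auto
    also have "T ` (h -` B \<inter> K) = H -` B \<inter> T ` K" using H by auto
    finally show "closed (H -` B \<inter> T ` K)" .
  qed
  then show ?thesis using H by (rule that)
qed

lemma cos_sin_eq_imp:
  assumes "s \<in> {0..1}" "t \<in> {0..1}" "cos (2 * pi * s) = cos (2 * pi * t)" "sin (2 * pi * s) = sin (2 * pi * t)"
  shows "s = t \<or> (s \<in> {0,1} \<and> t \<in> {0,1})"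
proof -
  have "sin (2 * pi * s) = sin (2 * pi * t) \<and> cos (2 * pi * s) = cos (2 * pi * t)" using assms by simp
  then obtain n :: int where n: "2 * pi * s = 2 * pi * t + 2 * pi * n"
    by (auto simp: sin_cos_eq_iff)
  have "2 * pi * s = 2 * pi * (t + n)" using n by (simp add: distrib_left)
  then have st: "s = t + n" by simp
  have "\<bar>real_of_int n\<bar> \<le> 1" using st assms(1,2) by auto
  then have "n = 0 \<or> n = 1 \<or> n = -1" by linarith
  then show ?thesis using st assms(1,2) by auto
qed

text \<open>In a coordinate where the points differ, equal cosines and sines force the values 0 and
  1. Functions vanishing on the boundary are therefore constant on fibres.\<close>

lemma torus_embedding_fibre:
  assumes "x \<in> cbox 0 1" "y \<in> cbox 0 1" "torus_embedding x = torus_embedding y" "x \<noteq> y"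
  shows "x \<in> frontier (cbox 0 1)" "y \<in> frontier (cbox 0 1)"
proof -
  obtain i where i: "x $ i \<noteq> y $ i" using assms(4) by (auto simp: vec_eq_iff)
  have "cos (2 * pi * x $ i) = cos (2 * pi * y $ i)" "sin (2 * pi * x $ i) = sin (2 * pi * y $ i)"
    using assms(3) by (auto simp: torus_embedding_def vec_eq_iff)
  then have "x $ i \<in> {0,1}" "y $ i \<in> {0,1}"
    using cos_sin_eq_imp[of "x $ i" "y $ i"] assms(1,2) i by (auto simp: mem_box_cart)
  then have "x \<notin> box 0 1" "y \<notin> box 0 1"
    by (auto simp: mem_box_cart) (metis less_irrefl)+
  then show "x \<in> frontier (cbox 0 1)" "y \<in> frontier (cbox 0 1)"
    using assms(1,2) by (auto simp: frontier_cbox)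
qed

section \<open>Completeness of the modes in mean square\<close>

definition approximable :: "(real^3 \<Rightarrow> real) \<Rightarrow> bool" where
  "approximable f \<longleftrightarrow> (\<forall>e>0. \<exists>p. trig_poly p \<and> (LINT x|torus. (cmod (of_real (f x) - p x))\<^sup>2) < e)"

lemma approximable_limit:
  assumes f: "square_integrable torus f"
    and g: "\<And>n::nat. square_integrable torus (g n)" "\<And>n. approximable (g n)"
    and lim: "(\<lambda>n. LINT x|torus. (f x - g n x)\<^sup>2) \<longlonglongrightarrow> 0"
  shows "approximable f"
  unfolding approximable_def
proof (intro allI impI)
  fix e :: real assume "e > 0"
  \<comment> \<open>Quarters, because squaring a sum costs a factor 2 on each of the two
    errors.\<close>
  then have "\<forall>\<^sub>F n in sequentially. (LINT x|torus. (f x - g n x)\<^sup>2) < e / 4"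
    using lim by (intro order_tendstoD) auto
  then obtain n where n: "(LINT x|torus. (f x - g n x)\<^sup>2) < e / 4"
    by (auto simp: eventually_sequentially)
  obtain p where p: "trig_poly p" "(LINT x|torus. (cmod (of_real (g n x) - p x))\<^sup>2) < e / 4"
    using g(2)[of n] \<open>e > 0\<close> unfolding approximable_def by (meson divide_pos_pos zero_less_numeral)
  have sq: "square_integrable torus (\<lambda>x. complex_of_real (h x))" if "square_integrable torus h" for h
    using that by (auto simp: square_integrable_def)
  have "(LINT x|torus. (cmod (of_real (f x) - p x))\<^sup>2) =
      (LINT x|torus. (cmod (complex_of_real (f x - g n x) + (of_real (g n x) - p x)))\<^sup>2)"
    by simp
  also have "\<dots> \<le> 2 * (LINT x|torus. (cmod (complex_of_real (f x - g n x)))\<^sup>2)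
        + 2 * (LINT x|torus. (cmod (of_real (g n x) - p x))\<^sup>2)"
    by (intro sq_integral_add_le sq square_integrable_diff f g continuous_square_integrable_torus trig_poly_continuous p)
  also have "\<dots> < e" using n p(2) by (simp del: of_real_diff)
  finally show "\<exists>p. trig_poly p \<and> (LINT x|torus. (cmod (of_real (f x) - p x))\<^sup>2) < e"
    using p(1) by blast
qed

text \<open>Vanishing on the boundary takes the place of periodicity: \<open>h\<close> descends to a
  continuous function on the image of the cube, where polynomials approximate it uniformly.\<close>

lemma approximable_continuous:
  assumes h: "continuous_on UNIV h" and zero: "\<And>x. x \<in> frontier (cbox 0 1) \<Longrightarrow> h x = 0"
  shows "approximable h"
  unfolding approximable_def
proof (intro allI impI)
  fix e :: real assume "e > 0"
  \<comment> \<open>The cell has measure 1, so a uniform error \<open>d\<close> gives a mean-square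
    error of at most \<open>e / 2\<close>.\<close>
  define d where "d = sqrt (e / 2)"
  have d: "d > 0" "d\<^sup>2 < e" using \<open>e > 0\<close> by (auto simp: d_def)
  have fib: "h x = h y" if "x \<in> cbox 0 1" "y \<in> cbox 0 1" "torus_embedding x = torus_embedding y" for x y
    using torus_embedding_fibre[OF that] zero by metis
  obtain H where H: "continuous_on (torus_embedding ` cbox 0 1) H"
    "\<And>x. x \<in> cbox 0 1 \<Longrightarrow> H (torus_embedding x) = h x"
    using continuous_factor[OF compact_cbox continuous_on_torus_embedding continuous_on_subset[OF h subset_UNIV] fib]
    by metis
  have "compact (torus_embedding ` cbox 0 1)"
    by (intro compact_continuous_image continuous_on_torus_embedding) auto
  then obtain g where g: "real_polynomial_function g"
    "\<And>s. s \<in> torus_embedding ` cbox 0 1 \<Longrightarrow> \<bar>H s - g s\<bar> < d"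
    using Stone_Weierstrass_real_polynomial_function[OF _ H(1) d(1)] by metis
  define p where "p x = complex_of_real (g (torus_embedding x))" for x
  have p: "trig_poly p"
    unfolding p_def by (rule trig_poly_real_polynomial_function[OF g(1)])
  have hp: "(cmod (of_real (h x) - p x))\<^sup>2 \<le> d\<^sup>2" if "x \<in> cbox 0 1" for x
  proof -
    have "cmod (of_real (h x) - p x) = \<bar>H (torus_embedding x) - g (torus_embedding x)\<bar>"
      unfolding p_def H(2)[OF that] by (metis norm_of_real of_real_diff real_norm_def)
    also have "\<dots> \<le> d" using g(2) that by (simp add: less_imp_le)
    finally show ?thesis by (intro power_mono) auto
  qed
  have "(LINT x|torus. (cmod (of_real (h x) - p x))\<^sup>2) \<le> (LINT x|torus. d\<^sup>2)"
    using hp by (intro integral_mono continuous_integrable_torus continuous_intros h trig_poly_continuous p) auto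
  also have "\<dots> < e" using d by simp
  finally show "\<exists>p. trig_poly p \<and> (LINT x|torus. (cmod (of_real (h x) - p x))\<^sup>2) < e"
    using p by blast
qed

lemma frontier_cbox_nonempty: "frontier (cbox 0 (1::real^3)) \<noteq> {}"
proof -
  have "0 \<in> frontier (cbox 0 (1::real^3))"
    by (auto simp: frontier_cbox mem_box_cart)
  then show ?thesis by blast
qed

text \<open>Measurability supplies continuous functions that converge almost everywhere. Truncating
  them at \<open>M\<close> provides domination, and a cut-off makes them vanish on the boundary,
  which is a null set.\<close>

lemma approximable_bounded:
  assumes f: "f \<in> borel_measurable torus" and bound: "\<And>x. \<bar>f x\<bar> \<le> M"
  shows "approximable f"
proof -
  have "f measurable_on cbox 0 1"
    using f by (subst measurable_on_iff_borel_measurable) (auto simp: torus_def)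
  then obtain N g where N: "negligible N" and g: "\<And>n. continuous_on UNIV (g n)"
    and lim: "\<And>x. x \<notin> N \<Longrightarrow> (\<lambda>n. g n x) \<longlonglongrightarrow> (if x \<in> cbox 0 1 then f x else 0)"
    unfolding measurable_on_def by blast
  have M: "M \<ge> 0" using bound[of 0] by linarith
  \<comment> \<open>At an interior point the distance to the boundary is positive, so the cut-off is
    eventually 1; on the boundary it is 0 for every \<open>n\<close>.\<close>
  define cut where "cut n x = min 1 (real n * infdist x (frontier (cbox 0 1)))" for n and x :: "real^3"
  define h where "h n x = cut n x * max (- M) (min M (g n x))" for n x
  have h: "continuous_on UNIV (h n)" for n
    unfolding h_def cut_def by (intro continuous_intros g)
  have h0: "h n x = 0" if "x \<in> frontier (cbox 0 1)" for n x
    using that by (simp add: h_def cut_def)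
  have hM: "\<bar>h n x\<bar> \<le> M" for n x
  proof -
    have "0 \<le> cut n x" "cut n x \<le> 1" by (auto simp: cut_def infdist_nonneg)
    moreover have "\<bar>max (- M) (min M (g n x))\<bar> \<le> M" using M by auto
    ultimately have "cut n x * \<bar>max (- M) (min M (g n x))\<bar> \<le> 1 * M"
      by (intro mult_mono) auto
    then show ?thesis using \<open>0 \<le> cut n x\<close> by (simp add: h_def abs_mult)
  qed
  have conv: "(\<lambda>n. h n x) \<longlonglongrightarrow> f x" if "x \<notin> N" "x \<in> box 0 1" for x
  proof -
    have "infdist x (frontier (cbox 0 1)) \<noteq> 0"
      using that(2) frontier_cbox_nonempty
      by (subst in_closed_iff_infdist_zero[symmetric]) (auto simp: frontier_cbox)
    then have pos: "infdist x (frontier (cbox 0 1)) > 0" using infdist_nonneg by (metis less_le)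
    obtain m :: nat where m: "1 \<le> real m * infdist x (frontier (cbox 0 1))"
      using reals_Archimedean3[OF pos] by (meson less_imp_le)
    have "cut n x = 1" if "n \<ge> m" for n
    proof -
      have "1 \<le> real n * infdist x (frontier (cbox 0 1))"
        using m that pos by (meson mult_right_mono less_imp_le of_nat_mono order_trans)
      then show ?thesis by (simp add: cut_def)
    qed
    then have "cut n x * max (- M) (min M (g n x)) = max (- M) (min M (g n x))" if "n \<ge> m" for n
      using that by simp
    then have ev: "\<forall>\<^sub>F n in sequentially. max (- M) (min M (g n x)) = h n x"
      unfolding h_def by (intro eventually_sequentiallyI[of m]) simp
    have "(\<lambda>n. g n x) \<longlonglongrightarrow> f x" using lim[OF that(1)] that(2) box_subset_cbox[of 0 "1::real^3"] by auto
    then have "(\<lambda>n. max (- M) (min M (g n x))) \<longlonglongrightarrow> max (- M) (min M (f x))"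
      by (intro tendsto_intros)
    also have "max (- M) (min M (f x)) = f x" using bound[of x] by auto
    finally show ?thesis using ev by (rule Lim_transform_eventually)
  qed
  have "negligible (N \<union> frontier (cbox 0 1))"
    using N by (simp add: negligible_Un_eq negligible_convex_frontier)
  then have "AE x in lebesgue. x \<notin> N \<union> frontier (cbox 0 1)"
    by (intro AE_not_in) (simp add: negligible_iff_null_sets)
  then have "AE x in torus. x \<notin> N \<union> frontier (cbox 0 1)"
    unfolding torus_def by (subst AE_restrict_space_iff) auto
  then have AE: "AE x in torus. (\<lambda>n. (f x - h n x)\<^sup>2) \<longlonglongrightarrow> 0"
  proof (rule AE_mp, intro AE_I2 impI)
    fix x assume "x \<in> space torus" "x \<notin> N \<union> frontier (cbox 0 1)"
    then have "(\<lambda>n. h n x) \<longlonglongrightarrow> f x" by (intro conv) (auto simp: frontier_cbox)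
    then have "(\<lambda>n. (f x - h n x)\<^sup>2) \<longlonglongrightarrow> (f x - f x)\<^sup>2" by (intro tendsto_intros)
    then show "(\<lambda>n. (f x - h n x)\<^sup>2) \<longlonglongrightarrow> 0" by simp
  qed
  have sqf: "square_integrable torus f"
  proof -
    have "(f x)\<^sup>2 \<le> M\<^sup>2" for x using bound[of x] by (metis abs_ge_zero power2_abs power_mono)
    then have "integrable torus (\<lambda>x. (f x)\<^sup>2)"
      using f by (intro torus.integrable_const_bound[of _ "M\<^sup>2"]) auto
    then show ?thesis using f by (simp add: square_integrable_def)
  qed
  have [measurable]: "h n \<in> borel_measurable torus" for n
    by (rule borel_measurable_torusI[OF h])
  note f[measurable]
  have "(\<lambda>n. LINT x|torus. (f x - h n x)\<^sup>2) \<longlonglongrightarrow> (LINT x|torus. 0)"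
  proof (rule integral_dominated_convergence[where w="\<lambda>_. (2 * M)\<^sup>2"])
    have "(f x - h n x)\<^sup>2 \<le> (2 * M)\<^sup>2" for x n
    proof -
      have "\<bar>f x - h n x\<bar> \<le> 2 * M" using bound[of x] hM[of n x] by linarith
      then have "\<bar>f x - h n x\<bar>\<^sup>2 \<le> (2 * M)\<^sup>2" by (intro power_mono) auto
      then show ?thesis by simp
    qed
    then show "AE x in torus. norm ((f x - h n x)\<^sup>2) \<le> (2 * M)\<^sup>2" for n by simp
  qed (use AE in \<open>simp_all\<close>)
  then have "(\<lambda>n. LINT x|torus. (f x - h n x)\<^sup>2) \<longlonglongrightarrow> 0" by simp
  with sqf continuous_square_integrable_torus[OF h] approximable_continuous[OF h h0]
  show ?thesis by (rule approximable_limit)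
qed

lemma approximable_square_integrable:
  assumes f: "square_integrable torus f"
  shows "approximable f"
proof -
  define g where "g n x = max (- real n) (min (real n) (f x))" for n x
  have fm [measurable]: "f \<in> borel_measurable torus" using f by (simp add: square_integrable_def)
  have gm [measurable]: "g n \<in> borel_measurable torus" for n unfolding g_def by measurable
  have gle: "\<bar>g n x\<bar> \<le> \<bar>f x\<bar>" "\<bar>f x - g n x\<bar> \<le> \<bar>f x\<bar>" for n x by (auto simp: g_def)
  have gsq: "square_integrable torus (g n)" for n
    by (rule square_integrable_bound[OF f]) (use gle in auto)
  have gap: "approximable (g n)" for n
    by (rule approximable_bounded[of _ "real n"]) (auto simp: g_def)
  have "(\<lambda>n. LINT x|torus. (f x - g n x)\<^sup>2) \<longlonglongrightarrow> (LINT x|torus. 0)"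
  proof (rule integral_dominated_convergence[where w="\<lambda>x. (f x)\<^sup>2"])
    show "integrable torus (\<lambda>x. (f x)\<^sup>2)" using f by (simp add: square_integrable_def)
    have "(f x - g n x)\<^sup>2 \<le> (f x)\<^sup>2" for x n using gle(2)[of x n] by (simp add: abs_le_square_iff)
    then show "AE x in torus. norm ((f x - g n x)\<^sup>2) \<le> (f x)\<^sup>2" for n by simp
    have "(\<lambda>n. (f x - g n x)\<^sup>2) \<longlonglongrightarrow> 0" for x
    proof (rule tendsto_eventually, rule eventually_sequentiallyI)
      fix n assume "n \<ge> nat \<lceil>\<bar>f x\<bar>\<rceil>"
      then have "\<bar>f x\<bar> \<le> real n" by linarith
      then show "(f x - g n x)\<^sup>2 = 0" by (auto simp: g_def)
    qed
    then show "AE x in torus. (\<lambda>n. (f x - g n x)\<^sup>2) \<longlonglongrightarrow> 0" by simp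
  qed simp_all
  then show ?thesis using approximable_limit[OF f gsq gap] by simp
qed

lemma fourier_sum_tendsto:
  assumes f: "square_integrable torus f"
  shows "(\<lambda>n. LINT x|torus. (cmod (of_real (f x) - trig_sum (freqs n) (fourier f) x))\<^sup>2) \<longlonglongrightarrow> 0"
proof (rule LIMSEQ_I)
  fix e :: real assume "e > 0"
  then obtain F c where F: "finite F" and c: "(LINT x|torus. (cmod (of_real (f x) - trig_sum F c x))\<^sup>2) < e"
    using approximable_square_integrable[OF f] unfolding approximable_def trig_poly_def by blast
  obtain m where m: "F \<subseteq> freqs m" using finite_subset_freqs[OF F] .
  show "\<exists>m. \<forall>n\<ge>m. norm ((LINT x|torus. (cmod (of_real (f x) - trig_sum (freqs n) (fourier f) x))\<^sup>2) - 0) < e"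
  proof (intro exI[of _ m] allI impI)
    fix n assume "n \<ge> m"
    then have "F \<subseteq> freqs n" using m freqs_mono by blast
    then have "(LINT x|torus. (cmod (of_real (f x) - trig_sum (freqs n) (fourier f) x))\<^sup>2) < e"
      using fourier_best_approximation[OF f finite_freqs, of F n c] c by linarith
    then show "norm ((LINT x|torus. (cmod (of_real (f x) - trig_sum (freqs n) (fourier f) x))\<^sup>2) - 0) < e"
      by (simp add: abs_of_nonneg)
  qed
qed

subsection \<open>Fourier approximation in the Sobolev space and the energy cancellation\<close>

text \<open>Test functions are real, so the weak derivative is tested with real parts of multiples
  of \<open>mode (- k)\<close>; the sign of \<open>- k\<close> in the multiplier absorbs the one
  from integration by parts. The multiples 1 and \<open>- \<i>\<close> recover real and imaginary
  parts.\<close>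

lemma weak_derivative_fourier:
  assumes f: "square_integrable torus f" and g: "square_integrable torus g"
    and weak: "\<And>\<psi>. \<psi> \<in> test_functions \<Longrightarrow>
      (LINT x|torus. f x * partial_deriv j \<psi> x) = - (LINT x|torus. g x * \<psi> x)"
  shows "fourier g k = dcoeff j (fourier f) k"
proof -
  have pair: "(LINT x|torus. h x * Re (trig_sum {- k} c x)) = Re (c (- k) * fourier h k)"
    if h: "square_integrable torus h" for h c
  proof -
    have "(LINT x|torus. h x * Re (trig_sum {- k} c x)) = (LINT x|torus. Re (c (- k) * (complex_of_real (h x) * cnj (mode k x))))"
      by (intro Bochner_Integration.integral_cong refl) (simp add: trig_sum_def cnj_mode algebra_simps)
    also have "\<dots> = Re (LINT x|torus. c (- k) * (complex_of_real (h x) * cnj (mode k x)))"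
      by (intro integral_Re Bochner_Integration.integrable_mult_right
          square_integrable_mult_continuous_integrable h continuous_intros)
    finally show ?thesis by (simp add: fourier_def)
  qed
  have "Re (a * (dcoeff j (fourier f) k - fourier g k)) = 0" for a
  proof -
    have "Re (dcoeff j (\<lambda>_. a) (- k) * fourier f k) = - Re (a * fourier g k)"
      using weak[OF Re_trig_sum_test_function[of "{- k}" "\<lambda>_. a"]]
      unfolding Re_trig_sum_derivative(2) pair[OF f] pair[OF g] .
    then show ?thesis by (simp add: dcoeff_def algebra_simps)
  qed
  from this[of 1] this[of "- \<i>"] show ?thesis by (simp add: complex_eq_iff)
qed

text \<open>Taking the real part makes the approximation real by construction, and it cannot
  increase the distance to a real function.\<close>

definition fourier_approx :: "(real^3 \<Rightarrow> real) \<Rightarrow> nat \<Rightarrow> real^3 \<Rightarrow> real" where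
  "fourier_approx f n x = Re (trig_sum (freqs n) (fourier f) x)"

lemma continuous_on_fourier_approx [continuous_intros]: "continuous_on S (fourier_approx f n)"
  unfolding fourier_approx_def by (intro continuous_intros)

lemma square_integrable_fourier_approx: "square_integrable torus (fourier_approx f n)"
  by (intro continuous_square_integrable_torus continuous_intros)

lemma fourier_approx_tendsto:
  assumes f: "square_integrable torus f"
  shows "(\<lambda>n. LINT x|torus. (f x - fourier_approx f n x)\<^sup>2) \<longlonglongrightarrow> 0"
proof (rule tendsto_sandwich[OF _ _ tendsto_const fourier_sum_tendsto[OF f]])
  have sq: "square_integrable torus (\<lambda>x. complex_of_real (f x) - trig_sum (freqs n) (fourier f) x)" for n
  proof (rule square_integrable_diff)
    show "square_integrable torus (\<lambda>x. complex_of_real (f x))"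
      using f by (auto simp: square_integrable_def)
  qed (intro continuous_square_integrable_torus continuous_intros)
  have "(LINT x|torus. (f x - fourier_approx f n x)\<^sup>2)
      \<le> (LINT x|torus. (cmod (complex_of_real (f x) - trig_sum (freqs n) (fourier f) x))\<^sup>2)" for n
  proof (rule integral_mono)
    show "integrable torus (\<lambda>x. (f x - fourier_approx f n x)\<^sup>2)"
      using square_integrable_diff[OF f square_integrable_fourier_approx] by (simp add: square_integrable_def)
    show "integrable torus (\<lambda>x. (cmod (complex_of_real (f x) - trig_sum (freqs n) (fourier f) x))\<^sup>2)"
      using sq by (simp add: square_integrable_def)
    show "(f x - fourier_approx f n x)\<^sup>2 \<le> (cmod (complex_of_real (f x) - trig_sum (freqs n) (fourier f) x))\<^sup>2" for x
      using abs_Re_le_cmod[of "complex_of_real (f x) - trig_sum (freqs n) (fourier f) x"]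
      by (simp add: fourier_approx_def abs_le_square_iff[symmetric])
  qed
  then show "\<forall>\<^sub>F n in sequentially. (LINT x|torus. (f x - fourier_approx f n x)\<^sup>2)
      \<le> (LINT x|torus. (cmod (complex_of_real (f x) - trig_sum (freqs n) (fourier f) x))\<^sup>2)"
    by simp
qed simp

text \<open>Bessel's inequality for \<open>f\<close> and for each weak derivative; the factor
  \<open>(2 * pi)\<^sup>2\<close> from the multiplier is at least 1 and is dropped.\<close>

lemma H1_fourier_bounded:
  assumes f: "square_integrable torus f" and g: "\<And>j. square_integrable torus (g j)"
    and weak: "\<And>\<psi> j. \<psi> \<in> test_functions \<Longrightarrow>
      (LINT x|torus. f x * partial_deriv j \<psi> x) = - (LINT x|torus. g j x * \<psi> x)"
    and "finite F"
  shows "(\<Sum>k\<in>F. bracket k * (cmod (fourier f k))\<^sup>2)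
      \<le> (LINT x|torus. (f x)\<^sup>2) + (\<Sum>j\<in>UNIV. LINT x|torus. (g j x)\<^sup>2)"
proof -
  have le: "(real_of_int (k $ j))\<^sup>2 * (cmod (fourier f k))\<^sup>2 \<le> (cmod (fourier (g j) k))\<^sup>2" for k j
  proof -
    have "1 \<le> (2 * pi)\<^sup>2" using pi_gt3 by (intro one_le_power) simp
    then have "1 * ((real_of_int (k $ j))\<^sup>2 * (cmod (fourier f k))\<^sup>2) \<le> (2 * pi)\<^sup>2 * ((real_of_int (k $ j))\<^sup>2 * (cmod (fourier f k))\<^sup>2)"
      by (intro mult_right_mono) auto
    also have "\<dots> = (cmod (fourier (g j) k))\<^sup>2"
    proof -
      have "fourier (g j) k = dcoeff j (fourier f) k"
        by (rule weak_derivative_fourier[OF f g weak])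
      then show ?thesis by (simp add: dcoeff_def norm_mult power_mult_distrib)
    qed
    finally show ?thesis by simp
  qed
  have "(\<Sum>k\<in>F. bracket k * (cmod (fourier f k))\<^sup>2) =
     (\<Sum>k\<in>F. (cmod (fourier f k))\<^sup>2) + (\<Sum>k\<in>F. \<Sum>j\<in>UNIV. (real_of_int (k $ j))\<^sup>2 * (cmod (fourier f k))\<^sup>2)"
    unfolding bracket_def by (simp add: distrib_right sum.distrib sum_distrib_right)
  also have "\<dots> \<le> (\<Sum>k\<in>F. (cmod (fourier f k))\<^sup>2) + (\<Sum>k\<in>F. \<Sum>j\<in>UNIV. (cmod (fourier (g j) k))\<^sup>2)"
    by (intro add_left_mono sum_mono le)
  also have "(\<Sum>k\<in>F. \<Sum>j\<in>UNIV. (cmod (fourier (g j) k))\<^sup>2) = (\<Sum>j\<in>UNIV. \<Sum>k\<in>F. (cmod (fourier (g j) k))\<^sup>2)"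
    by (rule sum.swap)
  also have "(\<Sum>k\<in>F. (cmod (fourier f k))\<^sup>2) + \<dots> \<le> (LINT x|torus. (f x)\<^sup>2) + (\<Sum>j\<in>UNIV. LINT x|torus. (g j x)\<^sup>2)"
    by (intro add_mono sum_mono Bessel f g \<open>finite F\<close>)
  finally show ?thesis .
qed

text \<open>The weighted coefficient sums \<open>a n\<close> increase to a limit \<open>L\<close>.
  The fourth-power bound for a difference of partial sums is controlled by \<open>L - a m\<close>
  uniformly in the upper index, so Fatou's lemma carries it over to
  \<open>f - fourier_approx f m\<close>. Finiteness and convergence both come from this
  estimate.\<close>

lemma H1_imp_L4:
  assumes f: "square_integrable torus f" and g: "\<And>j. square_integrable torus (g j)"
    and weak: "\<And>\<psi> j. \<psi> \<in> test_functions \<Longrightarrow>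
      (LINT x|torus. f x * partial_deriv j \<psi> x) = - (LINT x|torus. g j x * \<psi> x)"
  shows "square_integrable torus (\<lambda>x. (f x)\<^sup>2)"
    and "\<And>n. square_integrable torus (\<lambda>x. (f x - fourier_approx f n x)\<^sup>2)"
    and "(\<lambda>n. LINT x|torus. ((f x - fourier_approx f n x)\<^sup>2)\<^sup>2) \<longlonglongrightarrow> 0"
proof -
  let ?p = "fourier_approx f"
  define w where "w k = bracket k * (cmod (fourier f k))\<^sup>2" for k
  have w0: "w k \<ge> 0" for k by (simp add: w_def less_imp_le)
  define a where "a n = sum w (freqs n)" for n
  have a_mono: "mono a"
    unfolding mono_def a_def using w0 by (auto intro!: sum_mono2 freqs_mono)
  have "a n \<le> (LINT x|torus. (f x)\<^sup>2) + (\<Sum>j\<in>UNIV. LINT x|torus. (g j x)\<^sup>2)" for n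
    unfolding a_def w_def by (intro H1_fourier_bounded f g weak) auto
  then obtain L where L: "a \<longlonglongrightarrow> L" "\<And>n. a n \<le> L"
    using incseq_convergent[of a] a_mono by metis
  obtain C where C: "C \<ge> 0" "\<And>F c. finite F \<Longrightarrow>
    (LINT x|torus. (cmod (trig_sum F c x)) ^ 4) \<le> C * (\<Sum>k\<in>F. bracket k * (cmod (c k))\<^sup>2)\<^sup>2"
    using trig_sum_L4_bound by blast
  have diff: "(LINT x|torus. ((?p n x - ?p m x)\<^sup>2)\<^sup>2) \<le> C * (L - a m)\<^sup>2" if "m \<le> n" for m n
  proof -
    let ?F = "freqs n - freqs m"
    have sub: "freqs m \<subseteq> freqs n" using that by (rule freqs_mono)
    have tr: "trig_sum (freqs n) (fourier f) x - trig_sum (freqs m) (fourier f) x = trig_sum ?F (fourier f) x" for x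
      unfolding trig_sum_def by (rule sum_diff[OF finite_freqs sub, symmetric])
    have "(LINT x|torus. ((?p n x - ?p m x)\<^sup>2)\<^sup>2) \<le> (LINT x|torus. (cmod (trig_sum ?F (fourier f) x)) ^ 4)"
    proof (intro integral_mono continuous_integrable_torus continuous_intros)
      fix x
      have "(?p n x - ?p m x)\<^sup>2 \<le> (cmod (trig_sum ?F (fourier f) x))\<^sup>2"
        using abs_Re_le_cmod[of "trig_sum ?F (fourier f) x"]
        unfolding tr[symmetric] by (simp add: fourier_approx_def abs_le_square_iff[symmetric])
      then have "((?p n x - ?p m x)\<^sup>2)\<^sup>2 \<le> ((cmod (trig_sum ?F (fourier f) x))\<^sup>2)\<^sup>2"
        by (rule power_mono) simp
      then show "((?p n x - ?p m x)\<^sup>2)\<^sup>2 \<le> (cmod (trig_sum ?F (fourier f) x)) ^ 4"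
        by simp
    qed
    also have "\<dots> \<le> C * (sum w ?F)\<^sup>2"
      unfolding w_def by (intro C) simp
    also have "sum w ?F = a n - a m"
      unfolding a_def by (rule sum_diff[OF finite_freqs sub])
    \<comment> \<open>Replacing \<open>a n\<close> by its limit makes the bound independent of
      \<open>n\<close>, as the passage to the limit requires.\<close>
    also have "C * (a n - a m)\<^sup>2 \<le> C * (L - a m)\<^sup>2"
      using C(1) L(2)[of n] a_mono that by (intro mult_left_mono power_mono) (auto simp: mono_def)
    finally show ?thesis .
  qed
  have fm [measurable]: "f \<in> borel_measurable torus" using f by (simp add: square_integrable_def)
  have pm [measurable]: "?p n \<in> borel_measurable torus" for n
    by (intro borel_measurable_torusI continuous_intros)
  have int: "integrable torus (\<lambda>x. (f x - ?p n x)\<^sup>2)" for n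
    using square_integrable_diff[OF f square_integrable_fourier_approx] by (simp add: square_integrable_def)
  \<comment> \<open>Mean-square convergence yields pointwise convergence almost everywhere only
    along a subsequence.\<close>
  obtain r :: "nat \<Rightarrow> nat" where r: "strict_mono r" "AE x in torus. (\<lambda>n. (f x - ?p (r n) x)\<^sup>2) \<longlonglongrightarrow> 0"
    using tendsto_L1_AE_subseq[of torus "\<lambda>n x. (f x - ?p n x)\<^sup>2", OF int] fourier_approx_tendsto[OF f] by auto
  have lim: "integrable torus (\<lambda>x. ((f x - ?p m x)\<^sup>2)\<^sup>2) \<and>
      (LINT x|torus. ((f x - ?p m x)\<^sup>2)\<^sup>2) \<le> C * (L - a m)\<^sup>2" for m
  proof -
    \<comment> \<open>The shift by \<open>m\<close> guarantees \<open>m \<le> r (n + m)\<close>, so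
      that \<open>diff\<close> applies to every term.\<close>
    have AE: "AE x in torus. (\<lambda>n. ((?p (r (n + m)) x - ?p m x)\<^sup>2)\<^sup>2) \<longlonglongrightarrow> ((f x - ?p m x)\<^sup>2)\<^sup>2"
      using r(2)
    proof eventually_elim
      case (elim x)
      then have "(\<lambda>n. sqrt ((f x - ?p (r n) x)\<^sup>2)) \<longlonglongrightarrow> sqrt 0" by (intro tendsto_intros)
      then have "(\<lambda>n. \<bar>f x - ?p (r n) x\<bar>) \<longlonglongrightarrow> 0" by simp
      then have "(\<lambda>n. f x - ?p (r n) x) \<longlonglongrightarrow> 0" by (simp add: tendsto_rabs_zero_iff)
      then have "(\<lambda>n. f x - (f x - ?p (r n) x)) \<longlonglongrightarrow> f x - 0" by (intro tendsto_intros)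
      then have "(\<lambda>n. ?p (r n) x) \<longlonglongrightarrow> f x" by simp
      then have "(\<lambda>n. ?p (r (n + m)) x) \<longlonglongrightarrow> f x" by (rule LIMSEQ_ignore_initial_segment)
      then show ?case by (intro tendsto_intros)
    qed
    have "m \<le> r (n + m)" for n
      using seq_suble[OF r(1), of "n + m"] by linarith
    then have le: "(LINT x|torus. ((?p (r (n + m)) x - ?p m x)\<^sup>2)\<^sup>2) \<le> C * (L - a m)\<^sup>2" for n
      by (rule diff)
    have i: "integrable torus (\<lambda>x. ((?p (r (n + m)) x - ?p m x)\<^sup>2)\<^sup>2)" for n
      by (intro continuous_integrable_torus continuous_intros)
    have "(\<lambda>x. ((f x - ?p m x)\<^sup>2)\<^sup>2) \<in> borel_measurable torus" by measurable
    from Fatou_integral_le[where u="\<lambda>n x. ((?p (r (n + m)) x - ?p m x)\<^sup>2)\<^sup>2", OF i zero_le_power2 this AE le]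
    show ?thesis by blast
  qed
  show sq: "square_integrable torus (\<lambda>x. (f x - ?p n x)\<^sup>2)" for n
    using lim[of n] by (simp add: square_integrable_def)
  have "(\<lambda>m. C * (L - a m)\<^sup>2) \<longlonglongrightarrow> C * (L - L)\<^sup>2" by (intro tendsto_intros L)
  then have zero: "(\<lambda>m. C * (L - a m)\<^sup>2) \<longlonglongrightarrow> 0" by simp
  show "(\<lambda>n. LINT x|torus. ((f x - ?p n x)\<^sup>2)\<^sup>2) \<longlonglongrightarrow> 0"
    by (rule tendsto_sandwich[OF _ _ tendsto_const zero]) (use lim in simp_all)
  \<comment> \<open>\<open>f\<close> is split into its deviation from one partial sum, already
    controlled, and that continuous partial sum; the index 0 is an arbitrary choice.\<close>
  have "square_integrable torus (\<lambda>x. 2 *\<^sub>R (f x - ?p 0 x)\<^sup>2 + 2 *\<^sub>R (?p 0 x)\<^sup>2)"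
    by (intro square_integrable_add square_integrable_scaleR sq continuous_square_integrable_torus continuous_intros)
  then show "square_integrable torus (\<lambda>x. (f x)\<^sup>2)"
  proof (rule square_integrable_bound)
    fix x
    have "(f x)\<^sup>2 = ((f x - ?p 0 x) + ?p 0 x)\<^sup>2" by simp
    also have "\<dots> \<le> 2 *\<^sub>R (f x - ?p 0 x)\<^sup>2 + 2 *\<^sub>R (?p 0 x)\<^sup>2"
      using sum_squares_bound[of "f x - ?p 0 x" "?p 0 x"] unfolding power2_sum by simp
    finally show "norm ((f x)\<^sup>2) \<le> norm (2 *\<^sub>R (f x - ?p 0 x)\<^sup>2 + 2 *\<^sub>R (?p 0 x)\<^sup>2)" by simp
  qed measurable
qed

section \<open>Products and squares occurring in the cubic term\<close>

lemma square_integrable_mult_L4: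
  fixes a b :: "'a \<Rightarrow> real"
  assumes "square_integrable M (\<lambda>x. (a x)\<^sup>2)" "square_integrable M (\<lambda>x. (b x)\<^sup>2)"
    and m: "a \<in> borel_measurable M" "b \<in> borel_measurable M"
  shows "square_integrable M (\<lambda>x. a x * b x)"
proof (rule square_integrable_bound[OF square_integrable_add[OF assms(1,2)]])
  fix x
  have "2 * \<bar>a x\<bar> * \<bar>b x\<bar> \<le> (a x)\<^sup>2 + (b x)\<^sup>2" using sum_squares_bound[of "\<bar>a x\<bar>" "\<bar>b x\<bar>"] by simp
  moreover have "0 \<le> \<bar>a x\<bar> * \<bar>b x\<bar>" by simp
  moreover have "0 \<le> (a x)\<^sup>2 + (b x)\<^sup>2" by simp
  ultimately show "norm (a x * b x) \<le> norm ((a x)\<^sup>2 + (b x)\<^sup>2)"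
    unfolding real_norm_def abs_mult by linarith
qed (use m in measurable)

text \<open>Cauchy-Schwarz applied to the squares: a fixed factor with finite fourth-power integral
  turns fourth-power convergence into mean-square convergence of the product.\<close>

lemma tendsto_mult_L4:
  fixes a b :: "'a \<Rightarrow> real"
  assumes a: "square_integrable M (\<lambda>x. (a x)\<^sup>2)"
    and p: "\<And>n::nat. square_integrable M (\<lambda>x. (b x - p n x)\<^sup>2)"
    and lim: "(\<lambda>n. LINT x|M. ((b x - p n x)\<^sup>2)\<^sup>2) \<longlonglongrightarrow> 0"
  shows "(\<lambda>n. LINT x|M. (a x * b x - a x * p n x)\<^sup>2) \<longlonglongrightarrow> 0"
proof (rule tendsto_sandwich[OF _ _ tendsto_const])
  have "(LINT x|M. (a x * b x - a x * p n x)\<^sup>2)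
      \<le> sqrt (LINT x|M. ((a x)\<^sup>2)\<^sup>2) * sqrt (LINT x|M. ((b x - p n x)\<^sup>2)\<^sup>2)" for n
    using Cauchy_Schwarz_integral[OF a p[of n]]
    by (simp add: right_diff_distrib[symmetric] power_mult_distrib)
  then show "\<forall>\<^sub>F n in sequentially. (LINT x|M. (a x * b x - a x * p n x)\<^sup>2)
      \<le> sqrt (LINT x|M. ((a x)\<^sup>2)\<^sup>2) * sqrt (LINT x|M. ((b x - p n x)\<^sup>2)\<^sup>2)"
    by simp
  have "(\<lambda>n. sqrt (LINT x|M. ((a x)\<^sup>2)\<^sup>2) * sqrt (LINT x|M. ((b x - p n x)\<^sup>2)\<^sup>2))
     \<longlonglongrightarrow> sqrt (LINT x|M. ((a x)\<^sup>2)\<^sup>2) * sqrt 0"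
    by (intro tendsto_intros lim)
  then show "(\<lambda>n. sqrt (LINT x|M. ((a x)\<^sup>2)\<^sup>2) * sqrt (LINT x|M. ((b x - p n x)\<^sup>2)\<^sup>2)) \<longlonglongrightarrow> 0"
    by simp
qed simp

lemma trig_poly_cnj:
  assumes "trig_poly p"
  shows "trig_poly (\<lambda>x. cnj (p x))"
proof -
  obtain F c where "finite F" and p: "p = trig_sum F c" using assms by (auto simp: trig_poly_def)
  have "(\<lambda>x. cnj (p x)) = (\<lambda>x. \<Sum>k\<in>F. cnj (c k) * mode (- k) x)"
    unfolding p trig_sum_def by (simp add: cnj_mode)
  then show ?thesis by (simp only:) (intro trig_poly_sum trig_poly_mode)
qed

text \<open>For complex \<open>p\<close>, the square of \<open>Re p\<close> is the real part of
  \<open>(p * p + p * cnj p) / 2\<close>, which is again a trigonometric polynomial.\<close>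

lemma fourier_approx_square_test_function: "(\<lambda>x. (fourier_approx f n x)\<^sup>2) \<in> test_functions"
proof -
  let ?p = "trig_sum (freqs n) (fourier f)"
  have "trig_poly ?p" unfolding trig_poly_def using finite_freqs by blast
  then have "trig_poly (\<lambda>x. (1/2) * (?p x * ?p x) + (1/2) * (?p x * cnj (?p x)))"
    by (intro trig_poly_add trig_poly_mult trig_poly_cnj trig_poly_const)
  then obtain F c where *: "(\<lambda>x. (1/2) * (?p x * ?p x) + (1/2) * (?p x * cnj (?p x))) = trig_sum F c"
    by (auto simp: trig_poly_def)
  have "(fourier_approx f n x)\<^sup>2 = Re (trig_sum F c x)" for x
    unfolding *[symmetric] by (simp add: fourier_approx_def power2_eq_square field_simps)
  then show ?thesis by (simp add: Re_trig_sum_test_function)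
qed

lemma partial_deriv_fourier_approx:
  "partial_deriv j (fourier_approx f n) x = Re (trig_sum (freqs n) (dcoeff j (fourier f)) x)"
  using Re_trig_sum_derivative(2)[of j "freqs n" "fourier f" x] by (simp add: fourier_approx_def[abs_def])

lemma partial_deriv_fourier_approx_square:
  "partial_deriv j (\<lambda>x. (fourier_approx f n x)\<^sup>2) x = 2 * (fourier_approx f n x * partial_deriv j (fourier_approx f n) x)"
proof -
  let ?p = "fourier_approx f n"
  have "?p differentiable (at x)"
    unfolding fourier_approx_def[abs_def] by (rule Re_trig_sum_derivative(1))
  then have d: "(?p has_derivative frechet_derivative ?p (at x)) (at x)"
    by (simp add: frechet_derivative_works)
  have "((\<lambda>x. ?p x * ?p x) has_derivative
      (\<lambda>h. ?p x * frechet_derivative ?p (at x) h + frechet_derivative ?p (at x) h * ?p x)) (at x)"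
    by (rule has_derivative_mult[OF d d])
  from frechet_derivative_at[OF this, symmetric] show ?thesis
    by (simp add: partial_deriv_def power2_eq_square)
qed

lemma square_integrable_vec_nth:
  fixes f :: "'a \<Rightarrow> 'b::euclidean_space^'n"
  assumes "square_integrable M f"
  shows "square_integrable M (\<lambda>x. f x $ i)"
proof (rule square_integrable_bound[OF assms])
  have "(\<lambda>v::'b^'n. v $ i) \<in> borel_measurable borel"
    by (intro borel_measurable_continuous_onI continuous_intros)
  then show "(\<lambda>x. f x $ i) \<in> borel_measurable M"
    using square_integrable_measurable[OF assms] by (rule measurable_compose[rotated])
qed (simp add: Finite_Cartesian_Product.norm_nth_le)

lemma torus_L2_square_integrable: "f \<in> torus_L2 \<Longrightarrow> square_integrable torus f"
  by (simp add: torus_L2_def square_integrable_def)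

section \<open>The convection term of a field with square-integrable weak gradient\<close>

context
  fixes v :: "real^3 \<Rightarrow> real^3" and G :: "real^3 \<Rightarrow> real^3^3"
  assumes v: "v \<in> torus_L2" and G: "G \<in> torus_L2" and weak: "is_weak_grad v G"
begin

lemma weak_grad_components:
  "square_integrable torus (\<lambda>x. v x $ i)" "square_integrable torus (\<lambda>x. G x $ i $ k)"
  "\<psi> \<in> test_functions \<Longrightarrow>
      (LINT x|torus. v x $ i * partial_deriv k \<psi> x) = - (LINT x|torus. G x $ i $ k * \<psi> x)"
  by (intro square_integrable_vec_nth torus_L2_square_integrable v G)+
     (use weak in \<open>simp add: is_weak_grad_def\<close>)

lemma H1_component_L4: "square_integrable torus (\<lambda>x. (v x $ i)\<^sup>2)"
  by (rule H1_imp_L4(1)[OF weak_grad_components])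

text \<open>The gradient is square-integrable, and so is a product of two components with finite
  fourth-power integrals. As the integral of a non-integrable function is 0 by default, this is what
  justifies moving the sum over basis fields under the integral.\<close>

lemma convection_inner_integrable:
  assumes w: "w \<in> torus_L2" "\<And>i. square_integrable torus (\<lambda>x. (w x $ i)\<^sup>2)"
  shows "integrable torus (\<lambda>x. (G x *v v x) \<bullet> w x)"
proof -
  have wc: "square_integrable torus (\<lambda>x. w x $ i)" for i
    by (intro square_integrable_vec_nth torus_L2_square_integrable w)
  have "integrable torus (\<lambda>x. G x $ i $ k * (v x $ k * w x $ i))" for i k
    by (intro square_integrable_mult_integrable square_integrable_mult_L4 weak_grad_components H1_component_L4 w
        square_integrable_measurable[OF weak_grad_components(1)] square_integrable_measurable[OF wc])
  then have "integrable torus (\<lambda>x. \<Sum>i\<in>UNIV. \<Sum>k\<in>UNIV. G x $ i $ k * (v x $ k * w x $ i))"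
    by (intro Bochner_Integration.integrable_sum)
  then show ?thesis
    by (simp add: inner_vec_def matrix_vector_mult_def sum_distrib_right mult.assoc)
qed

text \<open>In the limit the gradient factor and the product of the other two factors each converge
  in mean square, which suffices for the integral of their product. \<open>G\<close> is any
  square-integrable weak gradient, so the result is independent of the choice made by
  \<open>weak_grad\<close>.\<close>

lemma convection_energy_zero:
  assumes div: "weakly_div_free v"
  shows "(LINT x|torus. (G x *v v x) \<bullet> v x) = 0"
proof -
  let ?p = "\<lambda>i. fourier_approx (\<lambda>x. v x $ i)"
  have vm: "(\<lambda>x. v x $ i) \<in> borel_measurable torus" for i
    by (rule square_integrable_measurable[OF weak_grad_components(1)])
  have vv: "square_integrable torus (\<lambda>x. v x $ k * v x $ i)" for i k
    by (intro square_integrable_mult_L4 H1_component_L4 vm)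
  have p4: "square_integrable torus (\<lambda>x. (?p i n x)\<^sup>2)" for i n
    by (intro continuous_square_integrable_torus continuous_intros)
  have vp: "square_integrable torus (\<lambda>x. v x $ k * ?p i n x)" for i k n
    by (intro square_integrable_mult_L4 H1_component_L4 p4 vm borel_measurable_torusI continuous_intros)
  \<comment> \<open>The derivatives of the partial sums of a component of \<open>v\<close> are
    partial sums of \<open>G\<close>, hence converge by the mean-square theory alone.\<close>
  have dp: "partial_deriv k (?p i n) = fourier_approx (\<lambda>x. G x $ i $ k) n" for i k n
  proof
    fix x
    have "dcoeff k (fourier (\<lambda>x. v x $ i)) = fourier (\<lambda>x. G x $ i $ k)"
      using weak_derivative_fourier[OF weak_grad_components] by auto
    then show "partial_deriv k (?p i n) x = fourier_approx (\<lambda>x. G x $ i $ k) n x"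
      by (simp add: partial_deriv_fourier_approx fourier_approx_def)
  qed
  have lim: "(\<lambda>n. LINT x|torus. (v x $ k * ?p i n x) * partial_deriv k (?p i n) x)
      \<longlonglongrightarrow> (LINT x|torus. (v x $ k * v x $ i) * G x $ i $ k)" for i k
    unfolding dp
    by (intro tendsto_integral_mult vv vp weak_grad_components square_integrable_fourier_approx
        fourier_approx_tendsto tendsto_mult_L4 H1_component_L4
        H1_imp_L4(2)[OF weak_grad_components] H1_imp_L4(3)[OF weak_grad_components])
  have zero: "(\<Sum>k\<in>UNIV. LINT x|torus. (v x $ k * ?p i n x) * partial_deriv k (?p i n) x) = 0" for i n
  proof -
    have int: "integrable torus (\<lambda>x. (v x $ k * ?p i n x) * partial_deriv k (?p i n) x)" for k
      unfolding dp by (intro square_integrable_mult_integrable vp square_integrable_fourier_approx)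
    \<comment> \<open>The exact field occupies the factor to which the divergence condition applies;
      differentiating the square supplies \<open>?p i n\<close> times its derivative, and a factor
      2.\<close>
    have "(LINT x|torus. (\<Sum>k\<in>UNIV. v x $ k * partial_deriv k (\<lambda>x. (?p i n x)\<^sup>2) x)) = 0"
      using div fourier_approx_square_test_function unfolding weakly_div_free_def by blast
    then have "(LINT x|torus. 2 * (\<Sum>k\<in>UNIV. (v x $ k * ?p i n x) * partial_deriv k (?p i n) x)) = 0"
      unfolding partial_deriv_fourier_approx_square by (simp add: sum_distrib_left mult_ac)
    then have "(LINT x|torus. (\<Sum>k\<in>UNIV. (v x $ k * ?p i n x) * partial_deriv k (?p i n) x)) = 0"
      by (simp only: integral_mult_right_zero mult_eq_0_iff) simp
    then show ?thesis using int by (simp only: Bochner_Integration.integral_sum)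
  qed
  have "(\<lambda>n. \<Sum>i\<in>UNIV. \<Sum>k\<in>UNIV. LINT x|torus. (v x $ k * ?p i n x) * partial_deriv k (?p i n) x)
     \<longlonglongrightarrow> (\<Sum>i\<in>UNIV. \<Sum>k\<in>UNIV. LINT x|torus. (v x $ k * v x $ i) * G x $ i $ k)"
    by (intro tendsto_sum lim)
  then have "(\<Sum>i\<in>UNIV. \<Sum>k\<in>UNIV. LINT x|torus. (v x $ k * v x $ i) * G x $ i $ k) = 0"
    unfolding zero by (simp add: LIMSEQ_const_iff)
  moreover have "(LINT x|torus. (G x *v v x) \<bullet> v x) =
      (LINT x|torus. (\<Sum>i\<in>UNIV. \<Sum>k\<in>UNIV. (v x $ k * v x $ i) * G x $ i $ k))"
    by (simp add: inner_vec_def matrix_vector_mult_def sum_distrib_right sum_distrib_left mult_ac)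
  moreover have "integrable torus (\<lambda>x. (v x $ k * v x $ i) * G x $ i $ k)" for i k
    by (intro square_integrable_mult_integrable vv weak_grad_components)
  ultimately show ?thesis
    by (simp only: Bochner_Integration.integral_sum Bochner_Integration.integrable_sum)
qed

end

subsection \<open>The reduced-order system\<close>

lemma test_function_continuous:
  assumes "\<psi> \<in> test_functions"
  shows "continuous_on S \<psi>" "continuous_on S (partial_deriv k \<psi>)"
proof -
  have "C_k 0 \<psi>" "C_k (Suc 0) \<psi>" using assms unfolding test_functions_def by blast+
  then have "continuous_on UNIV \<psi>" "continuous_on UNIV (partial_deriv k \<psi>)" by simp_all
  then show "continuous_on S \<psi>" "continuous_on S (partial_deriv k \<psi>)"
    by (auto intro: continuous_on_subset)
qed

lemma torus_L2_sum:
  fixes f :: "'n::finite \<Rightarrow> real^3 \<Rightarrow> 'a::euclidean_space"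
  assumes "\<And>j. f j \<in> torus_L2"
  shows "(\<lambda>x. \<Sum>j\<in>UNIV. z j *\<^sub>R f j x) \<in> torus_L2"
proof -
  have "square_integrable torus (\<lambda>x. \<Sum>j\<in>UNIV. z j *\<^sub>R f j x)"
    by (intro square_integrable_sum square_integrable_scaleR torus_L2_square_integrable assms)
  moreover have "periodic (\<lambda>x. \<Sum>j\<in>UNIV. z j *\<^sub>R f j x)"
    using assms by (simp add: torus_L2_def periodic_def)
  ultimately show ?thesis by (simp add: torus_L2_def square_integrable_def)
qed

lemma torus_L2_pairing_sum:
  fixes f :: "'n::finite \<Rightarrow> real^3 \<Rightarrow> real"
  assumes "\<And>j. square_integrable torus (f j)" "continuous_on UNIV h"
  shows "(LINT x|torus. (\<Sum>j\<in>UNIV. z j * f j x) * h x) = (\<Sum>j\<in>UNIV. z j * (LINT x|torus. f j x * h x))"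
proof -
  have "integrable torus (\<lambda>x. f j x * h x)" for j
    by (intro square_integrable_mult_integrable assms continuous_square_integrable_torus)
  then show ?thesis
    by (simp add: sum_distrib_right mult.assoc Bochner_Integration.integral_sum)
qed

text \<open>This provides the witness that a Galerkin field belongs to \<open>H1\<close>. Its
  \<open>weak_grad\<close> is a separate choice and need not equal the combination of the chosen
  gradients pointwise.\<close>

lemma is_weak_grad_sum:
  fixes \<phi> :: "'n::finite \<Rightarrow> real^3 \<Rightarrow> real^3"
  assumes \<phi>: "\<And>j. \<phi> j \<in> torus_L2" and G: "\<And>j. G j \<in> torus_L2" and weak: "\<And>j. is_weak_grad (\<phi> j) (G j)"
  shows "is_weak_grad (\<lambda>x. \<Sum>j\<in>UNIV. z j *\<^sub>R \<phi> j x) (\<lambda>x. \<Sum>j\<in>UNIV. z j *\<^sub>R G j x)"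
  unfolding is_weak_grad_def
proof (intro ballI allI)
  fix \<psi> i k assume \<psi>: "\<psi> \<in> test_functions"
  have "(LINT x|torus. (\<Sum>j\<in>UNIV. z j * \<phi> j x $ i) * partial_deriv k \<psi> x) = - (LINT x|torus. (\<Sum>j\<in>UNIV. z j * G j x $ i $ k) * \<psi> x)"
    using weak \<psi> weak_grad_components(1,2)[OF \<phi> G weak]
    by (simp add: torus_L2_pairing_sum test_function_continuous[OF \<psi>] is_weak_grad_def sum_negf)
  then show "(LINT x|torus. (\<Sum>j\<in>UNIV. z j *\<^sub>R \<phi> j x) $ i * partial_deriv k \<psi> x) =
      - (LINT x|torus. (\<Sum>j\<in>UNIV. z j *\<^sub>R G j x) $ i $ k * \<psi> x)"
    by simp
qed

lemma weakly_div_free_sum: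
  fixes \<phi> :: "'n::finite \<Rightarrow> real^3 \<Rightarrow> real^3"
  assumes \<phi>: "\<And>j. \<phi> j \<in> torus_L2" and div: "\<And>j. weakly_div_free (\<phi> j)"
  shows "weakly_div_free (\<lambda>x. \<Sum>j\<in>UNIV. z j *\<^sub>R \<phi> j x)"
  unfolding weakly_div_free_def
proof
  fix \<psi> assume \<psi>: "\<psi> \<in> test_functions"
  have int: "integrable torus (\<lambda>x. \<phi> j x $ k * partial_deriv k \<psi> x)" for j k
    by (intro square_integrable_mult_integrable square_integrable_vec_nth torus_L2_square_integrable \<phi>
        continuous_square_integrable_torus test_function_continuous \<psi>)
  have "(LINT x|torus. (\<Sum>k\<in>UNIV. (\<Sum>j\<in>UNIV. z j *\<^sub>R \<phi> j x) $ k * partial_deriv k \<psi> x)) =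
      (LINT x|torus. (\<Sum>j\<in>UNIV. z j * (\<Sum>k\<in>UNIV. \<phi> j x $ k * partial_deriv k \<psi> x)))"
  proof (intro Bochner_Integration.integral_cong refl)
    fix x
    show "(\<Sum>k\<in>UNIV. (\<Sum>j\<in>UNIV. z j *\<^sub>R \<phi> j x) $ k * partial_deriv k \<psi> x) =
        (\<Sum>j\<in>UNIV. z j * (\<Sum>k\<in>UNIV. \<phi> j x $ k * partial_deriv k \<psi> x))"
      unfolding sum_distrib_left by (subst sum.swap) (simp add: sum_distrib_right mult.assoc)
  qed
  also have "\<dots> = (\<Sum>j\<in>UNIV. z j * (LINT x|torus. (\<Sum>k\<in>UNIV. \<phi> j x $ k * partial_deriv k \<psi> x)))"
    using int by (simp add: Bochner_Integration.integral_sum Bochner_Integration.integrable_sum)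
  also have "\<dots> = 0" using div \<psi> by (simp add: weakly_div_free_def)
  finally show "(LINT x|torus. (\<Sum>k\<in>UNIV. (\<Sum>j\<in>UNIV. z j *\<^sub>R \<phi> j x) $ k * partial_deriv k \<psi> x)) = 0" .
qed

lemma weak_grad_spec:
  assumes "v \<in> H1"
  shows "weak_grad v \<in> torus_L2" "is_weak_grad v (weak_grad v)"
proof -
  have "\<exists>G. G \<in> torus_L2 \<and> is_weak_grad v G" using assms by (auto simp: H1_def)
  then have "weak_grad v \<in> torus_L2 \<and> is_weak_grad v (weak_grad v)"
    unfolding weak_grad_def by (rule someI_ex)
  then show "weak_grad v \<in> torus_L2" "is_weak_grad v (weak_grad v)" by auto
qed

text \<open>By linearity in the tested slot, pairing with \<open>z\<close> replaces the basis fields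
  by the Galerkin field itself, which produces the cubic integral that vanishes.\<close>

lemma inner_convection_zero:
  fixes \<phi> :: "'n::finite \<Rightarrow> real^3 \<Rightarrow> real^3"
  assumes \<phi>: "\<And>i. \<phi> i \<in> V"
  shows "z \<bullet> convection \<phi> z = 0"
proof -
  define v where "v = galerkin_field \<phi> z"
  have v_eq: "v = (\<lambda>x. \<Sum>j\<in>UNIV. z $ j *\<^sub>R \<phi> j x)"
    by (simp add: v_def fun_eq_iff galerkin_field_def)
  have \<phi>L2: "\<phi> i \<in> torus_L2" and \<phi>H1: "\<phi> i \<in> H1" and \<phi>div: "weakly_div_free (\<phi> i)" for i
    using \<phi>[of i] by (auto simp: V_def H1_def H_def)
  note \<phi>G = weak_grad_spec[OF \<phi>H1]
  have vL2: "v \<in> torus_L2" unfolding v_eq by (intro torus_L2_sum \<phi>L2)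
  have "is_weak_grad v (\<lambda>x. \<Sum>j\<in>UNIV. z $ j *\<^sub>R weak_grad (\<phi> j) x)"
    unfolding v_eq by (intro is_weak_grad_sum \<phi>L2 \<phi>G)
  moreover have "(\<lambda>x. \<Sum>j\<in>UNIV. z $ j *\<^sub>R weak_grad (\<phi> j) x) \<in> torus_L2"
    by (intro torus_L2_sum \<phi>G)
  ultimately have "v \<in> H1" using vL2 by (auto simp: H1_def)
  note vG = weak_grad_spec[OF this]
  have vdiv: "weakly_div_free v"
    unfolding v_eq by (intro weakly_div_free_sum \<phi>L2 \<phi>div)
  have int: "integrable torus (\<lambda>x. (weak_grad v x *v v x) \<bullet> \<phi> i x)" for i
    by (intro convection_inner_integrable[OF vL2 vG] \<phi>L2 H1_component_L4[OF \<phi>L2 \<phi>G])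
  have "z \<bullet> convection \<phi> z = - (\<Sum>i\<in>UNIV. z $ i * (LINT x|torus. (weak_grad v x *v v x) \<bullet> \<phi> i x))"
    by (simp add: convection_def v_def[symmetric] Let_def L2_inner_def inner_vec_def[of z] sum_negf)
  also have "(\<Sum>i\<in>UNIV. z $ i * (LINT x|torus. (weak_grad v x *v v x) \<bullet> \<phi> i x)) =
      (LINT x|torus. (\<Sum>i\<in>UNIV. z $ i * ((weak_grad v x *v v x) \<bullet> \<phi> i x)))"
    using int by (simp add: Bochner_Integration.integral_sum)
  also have "\<dots> = (LINT x|torus. (weak_grad v x *v v x) \<bullet> v x)"
    by (intro Bochner_Integration.integral_cong refl) (simp add: v_eq inner_sum_right)
  also have "\<dots> = 0" by (rule convection_energy_zero[OF vL2 vG vdiv])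
  finally show ?thesis by simp
qed

section \<open>Symmetry of the matrices and positivity of the damping\<close>

lemma L2_inner_commute: "L2_inner f g = L2_inner g f"
  by (simp add: L2_inner_def inner_commute)

lemma transpose_stiffness: "transpose (stiffness \<nu> \<phi>) = stiffness \<nu> \<phi>"
  by (simp add: transpose_def stiffness_def vec_eq_iff L2_inner_commute)

lemma transpose_damping: "transpose (damping c \<phi>) = damping c \<phi>"
  by (simp add: transpose_def damping_def vec_eq_iff L2_inner_def inner_commute)

text \<open>The quadratic form is the integral of \<open>c\<close> times the squared length of the
  Galerkin field. The essential bound on \<open>c\<close> makes each entry integrable, so that the
  double sum can be taken under the integral.\<close>

lemma damping_nonneg:
  fixes \<phi> :: "'n::finite \<Rightarrow> real^3 \<Rightarrow> real^3"
  assumes c: "c \<in> torus_Linf" "AE x in torus. 0 \<le> c x" and \<phi>: "\<And>i. \<phi> i \<in> torus_L2"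
  shows "0 \<le> z \<bullet> (damping c \<phi> *v z)"
proof -
  obtain C where C: "AE x in torus. \<bar>c x\<bar> \<le> C" and [measurable]: "c \<in> borel_measurable torus"
    using c(1) by (auto simp: torus_Linf_def)
  have sq: "square_integrable torus (\<phi> i)" for i by (rule torus_L2_square_integrable[OF \<phi>])
  have [measurable]: "\<phi> i \<in> borel_measurable torus" for i
    using sq by (simp add: square_integrable_def)
  have int: "integrable torus (\<lambda>x. (c x *\<^sub>R \<phi> i x) \<bullet> \<phi> j x)" for i j
  proof (rule Bochner_Integration.integrable_bound)
    show "integrable torus (\<lambda>x. C * (norm (\<phi> i x) * norm (\<phi> j x)))"
      by (intro Bochner_Integration.integrable_mult_right square_integrable_prod_integrable sq)
    show "AE x in torus. norm ((c x *\<^sub>R \<phi> i x) \<bullet> \<phi> j x) \<le> norm (C * (norm (\<phi> i x) * norm (\<phi> j x)))"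
      using C
    proof eventually_elim
      case (elim x)
      have "norm ((c x *\<^sub>R \<phi> i x) \<bullet> \<phi> j x) = \<bar>c x\<bar> * \<bar>\<phi> i x \<bullet> \<phi> j x\<bar>" by (simp add: abs_mult)
      also have "\<dots> \<le> C * (norm (\<phi> i x) * norm (\<phi> j x))"
        using elim Cauchy_Schwarz_ineq2[of "\<phi> i x" "\<phi> j x"] by (intro mult_mono) auto
      finally show ?case by (auto intro: order_trans[OF _ abs_ge_self])
    qed
  qed measurable
  have "z \<bullet> (damping c \<phi> *v z) = (\<Sum>i\<in>UNIV. \<Sum>j\<in>UNIV. z $ i * z $ j * (LINT x|torus. (c x *\<^sub>R \<phi> i x) \<bullet> \<phi> j x))"
    by (simp add: inner_vec_def[of z] matrix_vector_mult_def damping_def L2_inner_def sum_distrib_left mult_ac)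
  also have "\<dots> = (LINT x|torus. (\<Sum>i\<in>UNIV. \<Sum>j\<in>UNIV. z $ i * z $ j * ((c x *\<^sub>R \<phi> i x) \<bullet> \<phi> j x)))"
    using int by (simp only: Bochner_Integration.integral_sum Bochner_Integration.integrable_sum
        Bochner_Integration.integrable_mult_right integral_mult_right_zero)
  also have "\<dots> = (LINT x|torus. c x * (galerkin_field \<phi> z x \<bullet> galerkin_field \<phi> z x))"
    by (intro Bochner_Integration.integral_cong refl)
       (simp add: galerkin_field_def inner_sum_left inner_sum_right sum_distrib_left mult_ac inner_commute)
  also have "\<dots> \<ge> 0"
  proof (rule integral_nonneg_AE)
    show "AE x in torus. 0 \<le> c x * (galerkin_field \<phi> z x \<bullet> galerkin_field \<phi> z x)"
      using c(2) by eventually_elim simp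
  qed
  finally show ?thesis .
qed

lemma AE_lebesgue_on_negligible:
  assumes "AE x in lebesgue_on S. P x" "S \<in> sets lebesgue"
  shows "\<exists>N. negligible N \<and> (\<forall>x\<in>S - N. P x)"
proof -
  have "AE x in lebesgue. x \<in> S \<longrightarrow> P x"
    using assms by (subst (asm) AE_restrict_space_iff) auto
  then obtain N where "N \<in> null_sets lebesgue" "{x \<in> space lebesgue. \<not> (x \<in> S \<longrightarrow> P x)} \<subseteq> N"
    unfolding eventually_ae_filter by blast
  then show ?thesis by (auto simp: negligible_iff_null_sets)
qed

theorem proposition5p4:
  fixes \<nu> Kmin :: real
    and c :: "real^3 \<Rightarrow> real"
    and K :: "'r \<Rightarrow> real" and \<rho> :: "real \<Rightarrow> 'r"
    and \<phi> :: "'n::finite \<Rightarrow> real^3 \<Rightarrow> real^3"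
    and z :: "real \<Rightarrow> real^'n"
  assumes "\<nu> > 0"
    and "c \<in> torus_Linf" and "AE x in torus. 0 \<le> c x"
    and "bounded ((\<lambda>t. K (\<rho> t)) ` {0..})"
    and "(\<lambda>t. K (\<rho> t)) \<in> borel_measurable (lebesgue_on {0..})"
    and "\<And>t. t \<ge> 0 \<Longrightarrow> K (\<rho> t) \<ge> 0"
    and "\<And>i. \<phi> i \<in> V"
    and "\<And>i j. L2_inner (\<phi> i) (\<phi> j) = (if i = j then 1 else 0)"
    and "Kmin > 0" and "AE t in lebesgue_on {0..}. K (\<rho> t) \<ge> Kmin"
    and "\<And>T. T \<ge> 0 \<Longrightarrow> abs_continuous_on 0 T z"
    and "AE t in lebesgue_on {0..}.
           (z has_vector_derivative
              (- ((stiffness \<nu> \<phi> + K (\<rho> t) *\<^sub>R damping c \<phi>) *v z t) + convection \<phi> (z t))) (at t)"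
  shows "\<forall>t\<ge>0. norm (z t) \<le>
           exp (- lambda_min (stiffness \<nu> \<phi> + Kmin *\<^sub>R damping c \<phi>) * t) * norm (z 0)"
proof (intro allI impI)
  fix t :: real assume "t \<ge> 0"
  let ?S = "stiffness \<nu> \<phi>" and ?M = "damping c \<phi>"
  \<comment> \<open>The lower bound on the damping strength and the equation are merged first, so
    that one exceptional set serves both.\<close>
  have "AE s in lebesgue_on {0..}. Kmin \<le> K (\<rho> s) \<and> (z has_vector_derivative
            (- ((?S + K (\<rho> s) *\<^sub>R ?M) *v z s) + convection \<phi> (z s))) (at s)"
    using assms(10,12) by (rule AE_conjI)
  then have "\<exists>N. negligible N \<and> (\<forall>s\<in>{0..} - N. Kmin \<le> K (\<rho> s) \<and> (z has_vector_derivative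
            (- ((?S + K (\<rho> s) *\<^sub>R ?M) *v z s) + convection \<phi> (z s))) (at s))"
    by (rule AE_lebesgue_on_negligible) simp
  then obtain N where N: "negligible N"
    and Kz: "\<forall>s\<in>{0..} - N. Kmin \<le> K (\<rho> s) \<and> (z has_vector_derivative
            (- ((?S + K (\<rho> s) *\<^sub>R ?M) *v z s) + convection \<phi> (z s))) (at s)"
    by (elim exE conjE)
  have sym: "transpose (?S + Kmin *\<^sub>R ?M) = ?S + Kmin *\<^sub>R ?M"
    using transpose_stiffness[of \<nu> \<phi>] transpose_damping[of c \<phi>] by (simp add: transpose_def vec_eq_iff)
  have \<phi>: "\<phi> i \<in> torus_L2" for i using assms(7)[of i] by (simp add: V_def H_def)
  show "norm (z t) \<le> exp (- lambda_min (?S + Kmin *\<^sub>R ?M) * t) * norm (z 0)"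
  proof (rule energy_decay[OF \<open>t \<ge> 0\<close> assms(11)[OF \<open>t \<ge> 0\<close>] N])
    fix s assume s: "s \<in> {0..t}" "s \<notin> N"
    have "s \<in> {0..} - N" using s by simp
    note K = bspec[OF Kz this, THEN conjunct1] and z = bspec[OF Kz this, THEN conjunct2]
    let ?d = "- ((?S + K (\<rho> s) *\<^sub>R ?M) *v z s) + convection \<phi> (z s)"
    have split: "z s \<bullet> ((?S + k *\<^sub>R ?M) *v z s) = z s \<bullet> (?S *v z s) + k * (z s \<bullet> (?M *v z s))" for k
      by (simp add: matrix_vector_mult_add_rdistrib scaleR_matrix_vector_assoc[symmetric] inner_add_right)
    have "lambda_min (?S + Kmin *\<^sub>R ?M) * (norm (z s))\<^sup>2 \<le> z s \<bullet> ((?S + Kmin *\<^sub>R ?M) *v z s)"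
      by (rule lambda_min_le_Rayleigh[OF sym])
    \<comment> \<open>The form is affine in the damping strength with nonnegative slope, so raising
      the strength from \<open>Kmin\<close> to \<open>K (\<rho> s)\<close> cannot decrease
      it.\<close>
    also have "\<dots> \<le> z s \<bullet> ((?S + K (\<rho> s) *\<^sub>R ?M) *v z s)"
      unfolding split using K damping_nonneg[OF assms(2,3) \<phi>]
      by (intro add_left_mono mult_right_mono) auto
    \<comment> \<open>Convection drops out of the pairing with \<open>z s\<close>, leaving the
      linear part with reversed sign.\<close>
    finally have "z s \<bullet> ?d \<le> - lambda_min (?S + Kmin *\<^sub>R ?M) * (norm (z s))\<^sup>2"
      by (simp add: inner_add_right inner_diff_right inner_convection_zero[OF assms(7)])
    then show "\<exists>d. (z has_vector_derivative d) (at s) \<and>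
        z s \<bullet> d \<le> - lambda_min (?S + Kmin *\<^sub>R ?M) * (norm (z s))\<^sup>2"
      using z by (intro exI[of _ ?d] conjI)
  qed
qed

end
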